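(* Let $E$ be a countably order complete Banach lattice such that every positive, power-bounded and mean ergodic operator $T\colon E \to E$ is weakly almost periodic. Then $E$ is a KB-space.
   Context: "Operator" means linear operator. A bounded linear operator $T$ on a Banach space $X$ is called mean ergodic if the limit $\lim_{n\to\infty}\frac{1}{n}\sum_{k=0}^{n-1}T^k x$ exists (in norm) for every $x\in X$. It is called power-bounded if $\sup_{n\in\mathbb{N}}\|T^n\|<\infty$. It is called weakly almost periodic if $\{T^n x : n\in\mathbb{N}\}$ is relatively weakly compact in $X$ for every $x\in X$. An operator on a Banach lattice $E$ is positive if it maps the positive cone $E_+$ into itself. A Banach lattice is countably order complete (also: $\sigma$-Dedekind complete) if every non-empty countable order bounded subset has a supremum and an infimum. A Banach lattice $E$ is called a KB-space if every norm bounded increasing sequence in the positive cone $E_+$ is norm convergent. *)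

theory Defs
  imports "HOL-Analysis.Analysis" "HOL-Library.Lattice_Algebras" "HOL-Library.Lub_Glb"
begin

(* The axiom abs_lattice of the superclass fixes the modulus as sup x (- x). *)
class banach_lattice = banach + ordered_real_vector + lattice_ab_group_add_abs +
  assumes norm_mono_abs: "\<bar>x\<bar> \<le> \<bar>y\<bar> \<Longrightarrow> norm x \<le> norm y"

instance real :: banach_lattice
  by standard simp

definition countably_order_complete :: "'a::banach_lattice itself \<Rightarrow> bool" where
  "countably_order_complete _ \<longleftrightarrow>
     (\<forall>A::'a set. A \<noteq> {} \<and> countable A \<and> bdd_below A \<and> bdd_above A \<longrightarrow>
        (\<exists>s. isLub UNIV A s) \<and> (\<exists>i. isGlb UNIV A i))"

definition KB_space :: "'a::banach_lattice itself \<Rightarrow> bool" where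
  "KB_space _ \<longleftrightarrow>
     (\<forall>x::nat \<Rightarrow> 'a. (\<forall>n. 0 \<le> x n) \<and> incseq x \<and> bounded (range x) \<longrightarrow> convergent x)"

definition weak_topology :: "'a::real_normed_vector topology" where
  "weak_topology = topology_generated_by {f -` U | (f :: 'a \<Rightarrow> real) U. bounded_linear f \<and> open U}"

definition relatively_weakly_compact :: "'a::real_normed_vector set \<Rightarrow> bool" where
  "relatively_weakly_compact S \<longleftrightarrow> compactin weak_topology (weak_topology closure_of S)"

(* The following notions are meant for bounded linear operators T; boundedness and linearity
   are not part of the predicates and have to be assumed separately. *)

definition positive_operator :: "('a::banach_lattice \<Rightarrow> 'a) \<Rightarrow> bool" where
  "positive_operator T \<longleftrightarrow> (\<forall>x. 0 \<le> x \<longrightarrow> 0 \<le> T x)"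

definition power_bounded :: "('a::real_normed_vector \<Rightarrow> 'a) \<Rightarrow> bool" where
  "power_bounded T \<longleftrightarrow> bdd_above (range (\<lambda>n::nat. onorm (T ^^ n)))"

(* The term for n = 0 is 0 by convention and does not affect convergence. *)
definition mean_ergodic :: "('a::real_normed_vector \<Rightarrow> 'a) \<Rightarrow> bool" where
  "mean_ergodic T \<longleftrightarrow>
     (\<forall>x. convergent (\<lambda>n::nat. (1 / real n) *\<^sub>R (\<Sum>k<n. (T ^^ k) x)))"

definition weakly_almost_periodic :: "('a::real_normed_vector \<Rightarrow> 'a) \<Rightarrow> bool" where
  "weakly_almost_periodic T \<longleftrightarrow>
     (\<forall>x. relatively_weakly_compact (range (\<lambda>n::nat. (T ^^ n) x)))"

end

(* If E is not a KB-space, it contains disjoint positive vectors u_n of norm at least d > 0 whose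
   partial sums are norm bounded: order bounded ones if some order bounded increasing sequence
   diverges, and otherwise blocks of a norm bounded divergent increasing sequence after
   disjointification. Positive functionals biorthogonal to u_n make the copy of l^oo (respectively
   c_0) spanned by the u_n positively complemented, so it suffices to find a positive, power-bounded,
   mean ergodic operator on l^oo (respectively c_0) that is not weakly almost periodic.

   On l^oo, take a direct sum of 2x2 stochastic matrices with eigenvalues 1 and 1/(k+1) - 1. The
   means converge because the spectrum is isolated at 1, but the even powers of the second
   eigenvalue tend to 0 for each k while tending to 1 as k grows.

   On c_0, read the operator as the kernel of a branching walk: a walker (i+1, r) moves to (i+1, r+1),
   and at each power of three r >= i it also emits a particle at (0, r), which descends to (0, 0)
   and dies after reaching it. At any time at most one particle is alive, and the arrival times are
   so sparse that the means tend to 0, yet every walker with i <= 3^j started at r = 0 has a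
   particle at (0, 0) at the common time 2 * 3^j + 1. *)

theory Submission
  imports Defs "HOL-Library.Nat_Bijection"
begin

section \<open>Hahn--Banach for sublinear functionals\<close>

text \<open>The two operators cannot be exchanged. On null sequences a direct sum of finite blocks
  with uniformly bounded powers has relatively compact orbits, so there infinitely many coordinates
  have to be coupled. On bounded sequences the walk is not mean ergodic, because walkers shift the
  coordinates and a bounded sequence may have divergent means. Failure of weak almost periodicity is
  read off from coordinates. Along suitable times every coordinate of the powers converges, which
  prescribes the coordinates of any weak cluster point \<open>y\<close>. On l^oo they all vanish,
  while a generalized limit of the coordinates, a bounded functional, equals 1 along the powers. On
  c_0 infinitely many of them equal 1, while the coordinates of a vector tend to 0. For this last
  fact the biorthogonal functionals cannot be arbitrary: their values at a positive vector have to
  be controlled by its infima with multiples of \<open>u n\<close>.\<close>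

definition sublinear :: "('a::real_vector \<Rightarrow> real) \<Rightarrow> bool" where
  "sublinear p \<longleftrightarrow> (\<forall>x y. p (x + y) \<le> p x + p y) \<and> (\<forall>c x. 0 \<le> c \<longrightarrow> p (c *\<^sub>R x) = c * p x)"

text \<open>The tilt pushes the value at \<open>- x\<close> down to at most \<open>- m x\<close>.
  Take the infimum over \<open>t \<ge> 0\<close> of \<open>m (y + t x) - t m x\<close>: terms at
  \<open>t\<close> and \<open>s\<close> combine at \<open>t + s\<close>, which gives subadditivity,
  and \<open>t = 1\<close> gives the last conclusion.\<close>

lemma sublinear_tilt:
  fixes m :: "'a::real_vector \<Rightarrow> real"
  assumes "sublinear m"
  obtains r where "sublinear r" "r \<le> m" "\<And>y. r y \<le> m (y + x) - m x"
proof -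
  have msub: "m (a + b) \<le> m a + m b" and mhom: "0 \<le> c \<Longrightarrow> m (c *\<^sub>R a) = c * m a"
    for a b c using assms by (auto simp: sublinear_def)
  define g where "g y t = m (y + t *\<^sub>R x) - t * m x" for y t
  define r where "r y = (INF t\<in>{0..}. g y t)" for y
  have glow: "- m (- y) \<le> g y t" if "0 \<le> t" for y t
  proof -
    have "m (t *\<^sub>R x) \<le> m (y + t *\<^sub>R x) + m (- y)"
      using msub[of "y + t *\<^sub>R x" "- y"] by simp
    then show ?thesis using mhom[OF that] by (simp add: g_def)
  qed
  have bdd: "bdd_below (g y ` {0..})" for y
    by (rule bdd_belowI2[of _ "- m (- y)"]) (use glow in auto)
  have rle: "r y \<le> g y t" if "0 \<le> t" for y t
    unfolding r_def using that by (intro cINF_lower[OF bdd]) auto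
  have rge: "z \<le> r y" if "\<And>t. 0 \<le> t \<Longrightarrow> z \<le> g y t" for y z
    unfolding r_def using that by (intro cINF_greatest) auto
  have rm: "r \<le> m" using rle[of 0] by (auto simp: le_fun_def g_def)
  have "r (a + b) \<le> r a + r b" for a b
  proof -
    have "r (a + b) \<le> g a t + g b s" if "0 \<le> t" "0 \<le> s" for t s
    proof -
      have "r (a + b) \<le> g (a + b) (t + s)" using that by (intro rle) auto
      also have "\<dots> \<le> g a t + g b s"
        using msub[of "a + t *\<^sub>R x" "b + s *\<^sub>R x"] by (simp add: g_def algebra_simps)
      finally show ?thesis .
    qed
    then have "r (a + b) - g a t \<le> r b" if "0 \<le> t" for t
      using that by (intro rge) (auto simp: algebra_simps)
    then have "r (a + b) - r b \<le> r a" by (intro rge) (auto simp: algebra_simps)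
    then show ?thesis by simp
  qed
  moreover have "r (c *\<^sub>R a) = c * r a" if "0 \<le> c" for c a
  proof (cases "c = 0")
    case True
    have "r 0 \<le> 0" using rle[of 0 0] mhom[of 0 0] by (simp add: g_def)
    moreover have "0 \<le> r 0" using glow[of _ 0] mhom[of 0 0] by (intro rge) auto
    ultimately show ?thesis using True by simp
  next
    case False
    then have c: "c > 0" using that by simp
    have gs: "g (c *\<^sub>R a) (c * t) = c * g a t" for t
    proof -
      have "c *\<^sub>R a + (c * t) *\<^sub>R x = c *\<^sub>R (a + t *\<^sub>R x)" by (simp add: scaleR_add_right)
      then show ?thesis using mhom[of c "a + t *\<^sub>R x"] c by (simp add: g_def algebra_simps)
    qed
    show ?thesis
    proof (rule antisym)
      have "r (c *\<^sub>R a) / c \<le> r a"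
      proof (rule rge)
        fix t :: real assume "0 \<le> t"
        then show "r (c *\<^sub>R a) / c \<le> g a t"
          using rle[of "c * t" "c *\<^sub>R a"] gs[of t] c by (simp add: field_simps)
      qed
      then show "r (c *\<^sub>R a) \<le> c * r a" using c by (simp add: field_simps)
      show "c * r a \<le> r (c *\<^sub>R a)"
      proof (rule rge)
        fix t :: real assume "0 \<le> t"
        then have "c * r a \<le> c * g a (t / c)" using c by (intro mult_left_mono rle) auto
        then show "c * r a \<le> g (c *\<^sub>R a) t" using gs[of "t / c"] c by simp
      qed
    qed
  qed
  ultimately have "sublinear r" by (auto simp: sublinear_def)
  moreover have "r y \<le> m (y + x) - m x" for y using rle[of 1 y] by (simp add: g_def)
  ultimately show thesis using rm that by blast
qed

text \<open>A minimal sublinear functional is linear: tilting it in a direction gives a smaller one.\<close>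

lemma sublinear_dominates_linear:
  fixes p :: "'a::real_vector \<Rightarrow> real"
  assumes "sublinear p"
  obtains f where "linear f" "\<And>x. f x \<le> p x"
proof -
  define Q :: "('a \<Rightarrow> real) set" where
    "Q = {q. sublinear q \<and> q \<le> p}"
  \<comment> \<open>A common pointwise lower bound, so that infima over chains exist.\<close>
  have Q_low: "- p (- x) \<le> q x" if "q \<in> Q" for q x
  proof -
    have "q (x + - x) \<le> q x + q (- x)" "q (0 *\<^sub>R x) = 0 * q x" "q (- x) \<le> p (- x)"
      using that unfolding Q_def le_fun_def sublinear_def by blast+
    then show ?thesis by simp
  qed
  have "\<exists>m\<in>Q. \<forall>a\<in>Q. a \<le> m \<longrightarrow> a = m"
  proof (rule predicate_Zorn)
    show "partial_order_on Q (relation_of (\<lambda>a b. b \<le> a) Q)"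
      by (rule partial_order_on_relation_ofI) auto
    fix C assume C: "C \<in> Chains (relation_of (\<lambda>a b. b \<le> a) Q)"
    have CQ: "C \<subseteq> Q" using C by (auto simp: Chains_def relation_of_def)
    have Ctot: "a \<le> b \<or> b \<le> a" if "a \<in> C" "b \<in> C" for a b
      using C that by (auto simp: Chains_def relation_of_def)
    show "\<exists>u\<in>Q. \<forall>a\<in>C. u \<le> a"
    proof (cases "C = {}")
      case True
      have "p \<in> Q" using assms by (auto simp: Q_def)
      then show ?thesis using True by auto
    next
      case False
      define u where "u x = (INF q\<in>C. q x)" for x
      have bdd: "bdd_below ((\<lambda>q. q x) ` C)" for x
        by (rule bdd_belowI2[of _ "- p (- x)"]) (use Q_low CQ in auto)
      have ule: "u x \<le> q x" if "q \<in> C" for q x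
        unfolding u_def by (rule cINF_lower[OF bdd that])
      have uge: "z \<le> u x" if "\<And>q. q \<in> C \<Longrightarrow> z \<le> q x" for z x
        unfolding u_def by (rule cINF_greatest[OF False that])
      have "u (x + y) \<le> u x + u y" for x y
      proof -
        have *: "u (x + y) \<le> q x + r y" if qr: "q \<in> C" "r \<in> C" for q r
        proof -
          obtain s where s: "s \<in> C" "s \<le> q" "s \<le> r" using Ctot[OF qr] qr by blast
          have "u (x + y) \<le> s (x + y)" using ule s by auto
          also have "\<dots> \<le> s x + s y" using s CQ by (auto simp: Q_def sublinear_def)
          also have "\<dots> \<le> q x + r y" using s by (simp add: add_mono le_funD)
          finally show ?thesis .
        qed
        have "u (x + y) - q x \<le> u y" if "q \<in> C" for q
        proof (rule uge)
          fix r assume "r \<in> C"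
          then show "u (x + y) - q x \<le> r y" using *[of q r] that by simp
        qed
        then have "u (x + y) - u y \<le> u x" by (intro uge) (simp add: diff_le_eq add.commute)
        then show ?thesis by simp
      qed
      moreover have "u (c *\<^sub>R x) = c * u x" if "0 \<le> c" for c x
      proof (rule antisym)
        have q: "q (c *\<^sub>R x) = c * q x" if "q \<in> C" for q x
          using that \<open>0 \<le> c\<close> CQ by (auto simp: Q_def sublinear_def)
        show "c * u x \<le> u (c *\<^sub>R x)"
          by (rule uge) (simp add: q mult_left_mono ule that)
        show "u (c *\<^sub>R x) \<le> c * u x"
        proof (cases "c = 0")
          case True
          obtain q where "q \<in> C" using False by blast
          then show ?thesis using True ule[of q "c *\<^sub>R x"] q[of q x] by simp
        next
          case False
          have "u (c *\<^sub>R x) / c \<le> u x"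
          proof (rule uge)
            fix r assume "r \<in> C"
            then show "u (c *\<^sub>R x) / c \<le> r x"
              using ule[of r "c *\<^sub>R x"] q[of r x] False that by (simp add: field_simps)
          qed
          then show ?thesis using False that by (simp add: field_simps)
        qed
      qed
      moreover have "u \<le> p"
      proof -
        obtain q where "q \<in> C" using False by blast
        moreover have "q \<le> p" using calculation CQ by (auto simp: Q_def)
        ultimately show ?thesis using ule unfolding le_fun_def by (meson order_trans)
      qed
      ultimately have "u \<in> Q" by (auto simp: Q_def sublinear_def)
      then show ?thesis using ule by (auto simp: le_fun_def)
    qed
  qed
  then obtain m where mQ: "m \<in> Q" and mmin: "\<And>a. a \<in> Q \<Longrightarrow> a \<le> m \<Longrightarrow> a = m" by blast
  have msub: "m (x + y) \<le> m x + m y" and mhom: "0 \<le> c \<Longrightarrow> m (c *\<^sub>R x) = c * m x" and mp: "m x \<le> p x"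
    for x y c using mQ by (auto simp: Q_def le_fun_def sublinear_def)
  have msl: "sublinear m" using mQ by (simp add: Q_def)
  have add: "m (y + x) = m y + m x" for x y
  proof -
    obtain r where r: "sublinear r" "r \<le> m" "r y \<le> m (y + x) - m x"
      using sublinear_tilt[OF msl, of x] by blast
    then have "r \<in> Q" using mQ by (auto simp: Q_def intro: order_trans)
    then have "r = m" using r mmin by auto
    then show ?thesis using r(3) msub[of y x] by simp
  qed
  have m0: "m 0 = 0" using mhom[of 0 0] by simp
  have neg: "m (- x) = - m x" for x using add[of x "- x"] m0 by simp
  have "linear m"
  proof (rule linearI)
    show "m (b1 + b2) = m b1 + m b2" for b1 b2 by (rule add)
    show "m (c *\<^sub>R b) = c *\<^sub>R m b" for c b
    proof (cases "0 \<le> c")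
      case True then show ?thesis using mhom by simp
    next
      case False
      then show ?thesis using mhom[of "- c" b] neg[of "c *\<^sub>R b"] by simp
    qed
  qed
  then show thesis using that mp by blast
qed

text \<open>Tilting in the direction \<open>u\<close> before choosing the linear functional forces
  \<open>f (- u) \<le> - p u\<close>, so the domination is sharp at \<open>u\<close>.\<close>

lemma hahn_banach_sublinear:
  fixes p :: "'a::real_vector \<Rightarrow> real"
  assumes "sublinear p"
  obtains f where "linear f" "\<And>x. f x \<le> p x" "f u = p u"
proof -
  obtain r where r: "sublinear r" "r \<le> p" "\<And>y. r y \<le> p (y + u) - p u"
    using sublinear_tilt[OF assms] by blast
  obtain f where f: "linear f" "\<And>x. f x \<le> r x"
    using sublinear_dominates_linear[OF r(1)] by blast
  have fp: "f x \<le> p x" for x using f(2)[of x] r(2) by (auto simp: le_fun_def intro: order_trans)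
  have "p 0 = 0" using assms unfolding sublinear_def by (metis scaleR_zero_left mult_zero_left order_refl)
  then have "f (- u) \<le> - p u" using f(2)[of "- u"] r(3)[of "- u"] by simp
  then have "f u = p u" using fp[of u] linear_neg[OF f(1), of u] by simp
  then show thesis using that f(1) fp by blast
qed

section \<open>Banach lattices\<close>

declare scaleR_nonneg_nonneg [simp]

section \<open>Lattice inequalities, positive parts and disjointness\<close>

lemma norm_mono_pos:
  fixes x y :: "'a::banach_lattice"
  assumes "0 \<le> x" "x \<le> y"
  shows "norm x \<le> norm y"
  using assms by (intro norm_mono_abs) simp

lemma norm_pprt_le: "norm (pprt x) \<le> norm (x::'a::banach_lattice)"
proof (rule norm_mono_abs)
  show "\<bar>pprt x\<bar> \<le> \<bar>x\<bar>"
    by (simp add: abs_prts[of x])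
qed

lemma pprt_diff_inf: "pprt (a - b) = a - inf a (b::'a::lattice_ab_group_add)"
  by (simp add: pprt_def diff_inf_eq_sup add_sup_distrib_left sup_commute)

lemma pprt_add_le: "pprt (a + b) \<le> pprt a + pprt (b::'a::lattice_ab_group_add)"
proof -
  have "a + b \<le> pprt a + pprt b" by (intro add_mono) (simp_all add: pprt_def)
  then show ?thesis by (simp add: pprt_def)
qed

lemma inf_pprt_disjoint: "inf (pprt a) (pprt (- a)) = (0::'a::lattice_ab_group_add)"
proof -
  have "inf (a + pprt (- a)) (0 + pprt (- a)) = inf a 0 + pprt (- a)"
    by (simp add: add_inf_distrib_right)
  also have "\<dots> = 0" by (simp add: pprt_neg) (simp add: nprt_def)
  also have "a + pprt (- a) = pprt a" by (subst (1) prts[of a]) (simp add: pprt_neg)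
  finally show ?thesis by simp
qed

text \<open>By distributivity the right-hand side is the infimum of \<open>x + y\<close>,
  \<open>z + y\<close>, \<open>x + z\<close> and \<open>z + z\<close>, each of which is above
  \<open>x + y\<close> or above \<open>z\<close>.\<close>

lemma inf_add_le:
  fixes x y z :: "'a::lattice_ab_group_add"
  assumes "0 \<le> x" "0 \<le> y" "0 \<le> z"
  shows "inf (x + y) z \<le> inf x z + inf y z"
proof -
  have "inf x z + inf y z = inf (inf (x + y) (z + y)) (inf (x + z) (z + z))"
    by (simp add: add_inf_distrib_left add_inf_distrib_right)
  also have "\<dots> \<ge> inf (x + y) z"
    using assms by (auto intro: le_infI2 add_increasing add_increasing2)
  finally show ?thesis by simp
qed

lemma inf_scaleR:
  fixes x y :: "'a::banach_lattice"
  assumes "0 \<le> c"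
  shows "c *\<^sub>R inf x y = inf (c *\<^sub>R x) (c *\<^sub>R y)"
proof (cases "c = 0")
  case False
  then have c: "c > 0" using assms by simp
  show ?thesis
  proof (rule antisym)
    show "c *\<^sub>R inf x y \<le> inf (c *\<^sub>R x) (c *\<^sub>R y)"
      using assms by (simp add: scaleR_left_mono)
    have "inverse c *\<^sub>R inf (c *\<^sub>R x) (c *\<^sub>R y) \<le> inf x y"
    proof (rule le_infI)
      have "inverse c *\<^sub>R inf (c *\<^sub>R x) (c *\<^sub>R y) \<le> inverse c *\<^sub>R (c *\<^sub>R x)"
        using c by (intro scaleR_left_mono) auto
      then show "inverse c *\<^sub>R inf (c *\<^sub>R x) (c *\<^sub>R y) \<le> x" using c by simp
      have "inverse c *\<^sub>R inf (c *\<^sub>R x) (c *\<^sub>R y) \<le> inverse c *\<^sub>R (c *\<^sub>R y)"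
        using c by (intro scaleR_left_mono) auto
      then show "inverse c *\<^sub>R inf (c *\<^sub>R x) (c *\<^sub>R y) \<le> y" using c by simp
    qed
    then have "c *\<^sub>R (inverse c *\<^sub>R inf (c *\<^sub>R x) (c *\<^sub>R y)) \<le> c *\<^sub>R inf x y"
      using c by (intro scaleR_left_mono) auto
    then show "inf (c *\<^sub>R x) (c *\<^sub>R y) \<le> c *\<^sub>R inf x y" using c by simp
  qed
qed simp

lemma pprt_scaleR:
  fixes x :: "'a::banach_lattice"
  assumes "0 \<le> c"
  shows "pprt (c *\<^sub>R x) = c *\<^sub>R pprt x"
proof -
  have "pprt y = - inf (- y) 0" for y :: 'a by (simp add: pprt_def neg_inf_eq_sup)
  then show ?thesis using inf_scaleR[OF assms, of "- x" 0] by (simp del: neg_inf_eq_sup)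
qed

lemma inf_le_disjoint:
  fixes x y :: "'a::lattice_ab_group_add"
  assumes "0 \<le> x'" "x' \<le> x" "0 \<le> y'" "y' \<le> y" "inf x y = 0"
  shows "inf x' y' = 0"
proof (rule antisym)
  have "inf x' y' \<le> inf x y" using assms by (intro inf_mono)
  then show "inf x' y' \<le> 0" using assms by simp
qed (use assms in simp)

lemma inf_scaleR_disjoint:
  fixes x y :: "'a::banach_lattice"
  assumes "0 \<le> x" "0 \<le> y" "inf x y = 0" "0 \<le> c" "0 \<le> d"
  shows "inf (c *\<^sub>R x) (d *\<^sub>R y) = 0"
proof (rule inf_le_disjoint)
  show "c *\<^sub>R x \<le> (max c d) *\<^sub>R x" "d *\<^sub>R y \<le> (max c d) *\<^sub>R y"
    using assms by (auto intro: scaleR_right_mono)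
  show "inf (max c d *\<^sub>R x) (max c d *\<^sub>R y) = 0"
    using inf_scaleR[of "max c d" x y] assms by simp
qed (use assms in \<open>auto intro: scaleR_nonneg_nonneg\<close>)

lemma inf_sum_disjoint:
  fixes f :: "'i \<Rightarrow> 'a::lattice_ab_group_add"
  assumes "\<And>i. i \<in> F \<Longrightarrow> 0 \<le> f i" "0 \<le> x" "\<And>i. i \<in> F \<Longrightarrow> inf (f i) x = 0"
  shows "inf (sum f F) x = 0"
  using assms
proof (induction F rule: infinite_finite_induct)
  case (insert i F)
  have "inf (f i + sum f F) x \<le> inf (f i) x + inf (sum f F) x"
    using insert by (intro inf_add_le) (auto intro: sum_nonneg)
  also have "\<dots> = 0" using insert by auto
  finally have "inf (f i + sum f F) x \<le> 0" .
  moreover have "0 \<le> inf (f i + sum f F) x"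
    using insert by (auto intro!: add_nonneg_nonneg sum_nonneg)
  ultimately show ?case using insert by (auto intro: antisym)
qed (auto intro: inf_absorb1)

text \<open>A sum of pairwise disjoint positive elements is their supremum.\<close>

lemma sum_disjoint_le:
  fixes f :: "'i \<Rightarrow> 'a::lattice_ab_group_add"
  assumes "\<And>i. i \<in> F \<Longrightarrow> 0 \<le> f i" "\<And>i. i \<in> F \<Longrightarrow> f i \<le> x" "0 \<le> x"
    and "\<And>i j. i \<in> F \<Longrightarrow> j \<in> F \<Longrightarrow> i \<noteq> j \<Longrightarrow> inf (f i) (f j) = 0"
  shows "sum f F \<le> x"
  using assms
proof (induction F rule: infinite_finite_induct)
  case (insert i F)
  have "inf (sum f F) (f i) = 0"
    using insert by (intro inf_sum_disjoint) auto
  then have "sum f F + f i = sup (sum f F) (f i)" using add_eq_inf_sup[of "sum f F" "f i"] by simp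
  also have "\<dots> \<le> x"
  proof (rule le_supI)
    show "sum f F \<le> x" by (rule insert.IH) (use insert.prems in blast)+
    show "f i \<le> x" using insert.prems by blast
  qed
  finally show ?case using insert by (simp add: add.commute)
qed auto

text \<open>The negative part \<open>pprt (- x)\<close> of the limit lies below
  \<open>\<bar>f n - x\<bar>\<close> whenever \<open>f n\<close> is positive, so its norm is
  0.\<close>

lemma tendsto_nonneg_lattice:
  fixes f :: "nat \<Rightarrow> 'a::banach_lattice"
  assumes "f \<longlonglongrightarrow> x" "\<forall>\<^sub>F n in sequentially. 0 \<le> f n"
  shows "0 \<le> x"
proof -
  have *: "norm (pprt (- x)) \<le> norm (f n - x)" if "0 \<le> f n" for n
  proof (rule norm_mono_abs)
    have "- x \<le> pprt (f n - x)" using that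
      by (auto simp: pprt_def intro!: le_supI1)
    then have "pprt (- x) \<le> pprt (f n - x)" by (simp add: pprt_def)
    also have "\<dots> \<le> \<bar>f n - x\<bar>" by (simp add: abs_prts)
    finally show "\<bar>pprt (- x)\<bar> \<le> \<bar>f n - x\<bar>" by simp
  qed
  have "(\<lambda>n. norm (f n - x)) \<longlonglongrightarrow> 0"
    using assms(1) by (simp add: LIM_zero tendsto_norm_zero)
  then have "norm (pprt (- x)) \<le> 0"
  proof (rule tendsto_lowerbound)
    show "\<forall>\<^sub>F n in sequentially. norm (pprt (- x)) \<le> norm (f n - x)"
      using assms(2) by eventually_elim (rule *)
  qed simp
  then have "pprt (- x) = 0" by simp
  then show ?thesis using le_zero_iff_zero_pprt[of "- x"] by simp
qed

section \<open>Weak cluster points and positive functionals\<close>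

lemma weak_cluster_functional:
  fixes z :: "nat \<Rightarrow> 'a::real_normed_vector"
  assumes "relatively_weakly_compact S" "\<And>n. z n \<in> S"
  obtains y where "\<And>f l. bounded_linear f \<Longrightarrow> (\<lambda>n. f (z n)) \<longlonglongrightarrow> l \<Longrightarrow> f y = (l::real)"
proof -
  let ?W = "weak_topology :: 'a topology"
  have top: "topspace ?W = UNIV"
  proof -
    have "UNIV \<in> {f -` U | (f :: 'a \<Rightarrow> real) U. bounded_linear f \<and> open U}"
      by (auto intro!: exI[of _ "\<lambda>x. 0"] exI[of _ UNIV])
    then show ?thesis unfolding weak_topology_def topology_generated_by_topspace by blast
  qed
  have opn: "openin ?W (f -` U)" if "bounded_linear f" "open U" for f :: "'a \<Rightarrow> real" and U
    unfolding weak_topology_def using that by (intro topology_generated_by_Basis) auto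
  let ?K = "?W closure_of S"
  have K: "compactin ?W ?K" using assms(1) by (simp add: relatively_weakly_compact_def)
  have zK: "z n \<in> ?K" for n
    using closure_of_subset[of S ?W] assms(2) top by auto
  \<comment> \<open>A weak cluster point of the sequence: otherwise every point has a neighbourhood
    that the sequence eventually avoids, and finitely many of these cover the compact
    closure.\<close>
  have "\<exists>y. \<forall>U. openin ?W U \<and> y \<in> U \<longrightarrow> (\<exists>\<^sub>F n in sequentially. z n \<in> U)"
  proof (rule ccontr)
    assume "\<not> ?thesis"
    then have "\<forall>y. \<exists>U. openin ?W U \<and> y \<in> U \<and> (\<forall>\<^sub>F n in sequentially. z n \<notin> U)"
      by (auto simp: frequently_def)
    then obtain U where U: "\<And>y. openin ?W (U y)" "\<And>y. y \<in> U y"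
      "\<And>y. \<forall>\<^sub>F n in sequentially. z n \<notin> U y" by metis
    have "\<exists>\<F>. finite \<F> \<and> \<F> \<subseteq> range U \<and> ?K \<subseteq> \<Union>\<F>"
      using U by (intro compactinD[OF K]) auto
    then obtain \<F> where F: "finite \<F>" "\<F> \<subseteq> range U" "?K \<subseteq> \<Union>\<F>" by blast
    have "\<forall>\<^sub>F n in sequentially. \<forall>V\<in>\<F>. z n \<notin> V"
      using F U(3) by (intro eventually_ball_finite) auto
    then obtain n where "\<forall>V\<in>\<F>. z n \<notin> V" by (auto simp: eventually_sequentially)
    then show False using zK[of n] F(3) by auto
  qed
  then obtain y where y: "\<And>U. openin ?W U \<Longrightarrow> y \<in> U \<Longrightarrow> \<exists>\<^sub>F n in sequentially. z n \<in> U" by blast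
  have "f y = l" if f: "bounded_linear f" and l: "(\<lambda>n. f (z n)) \<longlonglongrightarrow> l" for f and l :: real
  proof (rule ccontr)
    assume ne: "f y \<noteq> l"
    let ?d = "dist (f y) l / 2"
    have d: "?d > 0" using ne by simp
    have "\<exists>\<^sub>F n in sequentially. z n \<in> f -` ball (f y) ?d"
      using d by (intro y opn[OF f open_ball]) auto
    moreover have "\<forall>\<^sub>F n in sequentially. dist (f (z n)) l < ?d"
      using l d by (rule tendstoD)
    ultimately have "\<exists>\<^sub>F n in sequentially. z n \<in> f -` ball (f y) ?d \<and> dist (f (z n)) l < ?d"
      by (rule frequently_eventually_frequently)
    then obtain n where "dist (f y) (f (z n)) < ?d" "dist (f (z n)) l < ?d"
      by (auto dest: frequently_ex)
    then show False using dist_triangle[of "f y" l "f (z n)"] by simp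
  qed
  then show thesis using that by blast
qed

lemma bounded_linear_if_dominated:
  fixes f :: "'a::real_normed_vector \<Rightarrow> real"
  assumes "linear f" "\<And>x. f x \<le> C * norm x"
  shows "bounded_linear f"
proof -
  have "norm (f x) \<le> norm x * C" for x
    using assms(2)[of x] assms(2)[of "- x"] linear_neg[OF assms(1), of x] by (simp add: abs_le_iff algebra_simps)
  then show ?thesis using assms(1) unfolding bounded_linear_def bounded_linear_axioms_def by blast
qed

text \<open>\<open>p\<close> measures the part of \<open>pprt x\<close> in the ideal generated by
  \<open>u\<close>. It is sublinear, equals \<open>norm u\<close> at \<open>u\<close>, and is at
  most 0 at negative elements and at positive elements disjoint from \<open>u\<close>; a linear
  functional below \<open>p\<close> that touches it at \<open>u\<close> inherits this. The last
  property comes from nearly attaining the supremum and later shows that functionals of a disjoint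
  sequence tend to 0 at each vector.\<close>

lemma disjoint_functional:
  fixes u :: "'a::banach_lattice"
  assumes u: "0 \<le> u" "u \<noteq> 0"
  obtains f :: "'a \<Rightarrow> real" where "linear f" "\<And>x. 0 \<le> x \<Longrightarrow> 0 \<le> f x" "f u = 1"
    "\<And>x. \<bar>f x\<bar> \<le> norm x / norm u"
    "\<And>x. 0 \<le> x \<Longrightarrow> inf x u = 0 \<Longrightarrow> f x = 0"
    "\<And>x e. 0 \<le> x \<Longrightarrow> 0 < e \<Longrightarrow> \<exists>k\<ge>0. norm u * f x \<le> norm (inf x (k *\<^sub>R u)) + e"
proof -
  define p where "p x = (SUP k\<in>{0..}. norm (inf (pprt x) (k *\<^sub>R u)))" for x
  have nb: "norm (inf (pprt x) (k *\<^sub>R u)) \<le> norm x" if "0 \<le> k" for x k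
  proof -
    have "norm (inf (pprt x) (k *\<^sub>R u)) \<le> norm (pprt x)"
      using u that by (intro norm_mono_pos) auto
    then show ?thesis using norm_pprt_le[of x] by simp
  qed
  have bdd: "bdd_above ((\<lambda>k. norm (inf (pprt x) (k *\<^sub>R u))) ` {0..})" for x
    by (rule bdd_aboveI2[of _ _ "norm x"]) (use nb in auto)
  have le_p: "norm (inf (pprt x) (k *\<^sub>R u)) \<le> p x" if "0 \<le> k" for x k
    unfolding p_def using that by (intro cSUP_upper bdd) auto
  have p_le: "p x \<le> c" if "\<And>k. 0 \<le> k \<Longrightarrow> norm (inf (pprt x) (k *\<^sub>R u)) \<le> c" for x c
    unfolding p_def using that by (intro cSUP_least) auto
  have "p (x + y) \<le> p x + p y" for x y
  proof (rule p_le)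
    fix k :: real assume k: "0 \<le> k"
    have "inf (pprt (x + y)) (k *\<^sub>R u) \<le> inf (pprt x + pprt y) (k *\<^sub>R u)"
      by (intro inf_mono pprt_add_le) auto
    also have "\<dots> \<le> inf (pprt x) (k *\<^sub>R u) + inf (pprt y) (k *\<^sub>R u)"
      using u k by (intro inf_add_le) auto
    finally have "norm (inf (pprt (x + y)) (k *\<^sub>R u)) \<le> norm (inf (pprt x) (k *\<^sub>R u) + inf (pprt y) (k *\<^sub>R u))"
      using u k by (intro norm_mono_pos) auto
    also have "\<dots> \<le> p x + p y"
      using le_p[OF k, of x] le_p[OF k, of y] by (intro norm_triangle_le) simp
    finally show "norm (inf (pprt (x + y)) (k *\<^sub>R u)) \<le> p x + p y" .
  qed
  moreover have p0: "p 0 = 0"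
  proof (rule antisym)
    show "p 0 \<le> 0" using nb[of _ 0] by (intro p_le) auto
    show "0 \<le> p 0" using le_p[of 0 0] u by simp
  qed
  have hle: "c * p x \<le> p (c *\<^sub>R x)" if c: "0 < c" for c x
  proof -
    have "p x \<le> p (c *\<^sub>R x) / c"
    proof (rule p_le)
      fix k :: real assume k: "0 \<le> k"
      have "c * norm (inf (pprt x) (k *\<^sub>R u)) = norm (c *\<^sub>R inf (pprt x) (k *\<^sub>R u))" using c by simp
      also have "\<dots> = norm (inf (pprt (c *\<^sub>R x)) ((c * k) *\<^sub>R u))"
        using c by (simp add: inf_scaleR pprt_scaleR)
      also have "\<dots> \<le> p (c *\<^sub>R x)" using c k by (intro le_p) auto
      finally show "norm (inf (pprt x) (k *\<^sub>R u)) \<le> p (c *\<^sub>R x) / c"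
        using c by (simp add: field_simps)
    qed
    then show ?thesis using c by (simp add: field_simps)
  qed
  have "p (c *\<^sub>R x) = c * p x" if "0 \<le> c" for c x
  proof (cases "c = 0")
    case False
    then have c: "c > 0" using that by simp
    show ?thesis using hle[OF c, of x] hle[of "inverse c" "c *\<^sub>R x"] c by (simp add: field_simps)
  qed (simp add: p0)
  ultimately have "sublinear p" by (auto simp: sublinear_def)
  then obtain g where g: "linear g" "\<And>x. g x \<le> p x" "g u = p u"
    using hahn_banach_sublinear by blast
  have pn: "p x \<le> norm x" for x using nb by (intro p_le)
  have pu: "p u = norm u"
    using le_p[of 1 u] u pn[of u] by simp
  have nu: "norm u > 0" using u by simp
  have gpos: "0 \<le> g x" if "0 \<le> x" for x
  proof -
    have "p (- x) \<le> 0"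
    proof (rule p_le)
      fix k :: real assume "0 \<le> k"
      then have "inf 0 (k *\<^sub>R u) = 0" using u by (intro inf_absorb1) auto
      then show "norm (inf (pprt (- x)) (k *\<^sub>R u)) \<le> 0" using that by simp
    qed
    then show ?thesis using g(2)[of "- x"] linear_neg[OF g(1), of x] by simp
  qed
  have gabs: "\<bar>g x\<bar> \<le> norm x" for x
    using g(2)[of x] g(2)[of "- x"] pn[of x] pn[of "- x"] linear_neg[OF g(1), of x] by simp
  show thesis
  proof (rule that[of "\<lambda>x. g x / norm u"])
    show "linear (\<lambda>x. g x / norm u)"
      using linear_compose_scale_right[OF g(1), of "1 / norm u"] by simp
    show "g u / norm u = 1" using g pu nu by simp
    show "0 \<le> g x / norm u" if "0 \<le> x" for x using gpos[OF that] nu by simp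
    show "\<bar>g x / norm u\<bar> \<le> norm x / norm u" for x
      using gabs[of x] nu by (simp add: divide_right_mono)
    show "g x / norm u = 0" if "0 \<le> x" "inf x u = 0" for x
    proof -
      have "p x \<le> 0"
      proof (rule p_le)
        fix k :: real assume "0 \<le> k"
        then show "norm (inf (pprt x) (k *\<^sub>R u)) \<le> 0"
          using inf_scaleR_disjoint[of x u 1 k] that u by simp
      qed
      then show ?thesis using gpos[OF that(1)] g(2)[of x] by simp
    qed
    show "\<exists>k\<ge>0. norm u * (g x / norm u) \<le> norm (inf x (k *\<^sub>R u)) + e" if "0 \<le> x" "0 < e" for x e
    proof -
      have "\<exists>k\<ge>0. p x - e < norm (inf (pprt x) (k *\<^sub>R u))"
      proof (rule ccontr)
        assume "\<not> ?thesis"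
        then have "p x \<le> p x - e" by (intro p_le) (simp add: not_less)
        then show False using that by simp
      qed
      then obtain k where "0 \<le> k" "p x - e < norm (inf (pprt x) (k *\<^sub>R u))" by blast
      then show ?thesis using that nu g(2)[of x] by (intro exI[of _ k]) simp
    qed
  qed
qed

section \<open>Operators factoring through sequence spaces\<close>

text \<open>The functionals form a positive left inverse of \<open>J\<close>, so \<open>J\<close>
  after the coordinate map is a positive projection. Arbitrary bounds \<open>c\<close> stand for the
  sup norm, which lets one locale serve both bounded and null sequences.\<close>

locale sequence_copy =
  fixes L :: "('i \<Rightarrow> real) set" and J :: "('i \<Rightarrow> real) \<Rightarrow> 'a::banach_lattice"
    and \<phi> :: "'i \<Rightarrow> 'a \<Rightarrow> real" and C D :: real
  assumes L_add: "a \<in> L \<Longrightarrow> b \<in> L \<Longrightarrow> (\<lambda>i. a i + b i) \<in> L"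
    and L_scale: "a \<in> L \<Longrightarrow> (\<lambda>i. c * a i) \<in> L"
    and J_add: "a \<in> L \<Longrightarrow> b \<in> L \<Longrightarrow> J (\<lambda>i. a i + b i) = J a + J b"
    and J_scale: "a \<in> L \<Longrightarrow> J (\<lambda>i. c * a i) = c *\<^sub>R J a"
    and J_pos: "a \<in> L \<Longrightarrow> (\<And>i. 0 \<le> a i) \<Longrightarrow> 0 \<le> J a"
    and J_bound: "a \<in> L \<Longrightarrow> (\<And>i. \<bar>a i\<bar> \<le> c) \<Longrightarrow> norm (J a) \<le> C * c"
    and phi_linear: "linear (\<phi> i)"
    and phi_pos: "0 \<le> x \<Longrightarrow> 0 \<le> \<phi> i x"
    and phi_bound: "\<bar>\<phi> i x\<bar> \<le> D * norm x"
    and phi_L: "(\<lambda>i. \<phi> i x) \<in> L"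
    and phi_J: "a \<in> L \<Longrightarrow> \<phi> i (J a) = a i"
begin

lemma L_sum: "(\<And>n. n \<in> F \<Longrightarrow> f n \<in> L) \<Longrightarrow> (\<lambda>i. \<Sum>n\<in>F. f n i) \<in> L"
proof (induction F rule: infinite_finite_induct)
  case empty
  then show ?case using L_scale[OF phi_L, of 0] by simp
next
  case (insert n F)
  then show ?case using L_add[of "f n" "\<lambda>i. \<Sum>n\<in>F. f n i"] by simp
qed (use L_scale[OF phi_L, of 0] in simp)

lemma J_zero: "J (\<lambda>i. 0) = 0"
  using J_scale[OF phi_L, of 0] by simp

lemma J_sum: "(\<And>n. n \<in> F \<Longrightarrow> f n \<in> L) \<Longrightarrow> J (\<lambda>i. \<Sum>n\<in>F. f n i) = (\<Sum>n\<in>F. J (f n))"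
proof (induction F rule: infinite_finite_induct)
  case (insert n F)
  then show ?case using J_add[of "f n" "\<lambda>i. \<Sum>n\<in>F. f n i"] L_sum[of F f] by simp
qed (simp_all add: J_zero)

lemma J_diff:
  assumes "a \<in> L" "b \<in> L"
  shows "(\<lambda>i. a i - b i) \<in> L" "J (\<lambda>i. a i - b i) = J a - J b"
  using L_add[OF assms(1) L_scale[OF assms(2), of "-1"]]
    J_add[OF assms(1) L_scale[OF assms(2), of "-1"]] J_scale[OF assms(2), of "-1"] by simp_all

lemma phi_add: "\<phi> i (x + y) = \<phi> i x + \<phi> i y"
  and phi_scale: "\<phi> i (c *\<^sub>R x) = c * \<phi> i x"
  using linear_add[OF phi_linear] linear_scale[OF phi_linear] by simp_all

lemma C_nonneg: "0 \<le> C"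
proof -
  have "\<phi> i 0 = 0" for i using phi_scale[of i 0 0] by simp
  then have "norm (J (\<lambda>i. \<phi> i 0)) \<le> C * 1" by (intro J_bound phi_L) simp
  then have "0 \<le> C * 1" by (rule order_trans[OF norm_ge_zero])
  then show ?thesis by simp
qed

lemma bounded_linear_phi: "bounded_linear (\<phi> i)"
  by (rule bounded_linear_if_dominated[OF phi_linear, of _ D]) (use phi_bound in \<open>simp add: abs_le_iff\<close>)

end

text \<open>The bound on the powers and the convergence of the means are uniform over the
  coordinates, so \<open>J_bound\<close> turns them into statements about the norm.\<close>

locale sequence_operator = sequence_copy L J \<phi> C D
  for L :: "('i \<Rightarrow> real) set" and J :: "('i \<Rightarrow> real) \<Rightarrow> 'a::banach_lattice" and \<phi> C D +
  fixes A :: "('i \<Rightarrow> real) \<Rightarrow> 'i \<Rightarrow> real" and K :: real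
  assumes A_L: "a \<in> L \<Longrightarrow> A a \<in> L"
    and A_add: "A (\<lambda>i. a i + b i) = (\<lambda>i. A a i + A b i)"
    and A_scale: "A (\<lambda>i. c * a i) = (\<lambda>i. c * A a i)"
    and A_pos: "(\<And>i. 0 \<le> a i) \<Longrightarrow> 0 \<le> A a i"
    and A_bound: "(\<And>i. \<bar>a i\<bar> \<le> c) \<Longrightarrow> \<bar>(A ^^ n) a i\<bar> \<le> K * c"
    and A_mean: "a \<in> L \<Longrightarrow> \<exists>b\<in>L. \<forall>e>0. \<forall>\<^sub>F N in sequentially.
      \<forall>i. \<bar>(1 / real N) * (\<Sum>n<N. (A ^^ n) a i) - b i\<bar> \<le> e"
begin

definition T :: "'a \<Rightarrow> 'a" where
  "T x = J (A (\<lambda>i. \<phi> i x))"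

lemma An_L: "a \<in> L \<Longrightarrow> (A ^^ n) a \<in> L"
  by (induction n) (auto simp: A_L)

lemma Tn_J: "a \<in> L \<Longrightarrow> (T ^^ n) (J a) = J ((A ^^ n) a)"
  by (induction n) (simp_all add: T_def phi_J An_L)

text \<open>Inner factors cancel because the coordinates of \<open>J a\<close> are \<open>a\<close>.
  Power 0 is excluded: it is the identity, not the projection onto the copy.\<close>

lemma Tn: "(T ^^ Suc n) x = J ((A ^^ Suc n) (\<lambda>i. \<phi> i x))"
proof -
  have "(T ^^ Suc n) x = (T ^^ n) (T x)" by (simp add: funpow_swap1)
  also have "\<dots> = J ((A ^^ n) (A (\<lambda>i. \<phi> i x)))"
    unfolding T_def[of x] by (rule Tn_J[OF A_L[OF phi_L]])
  finally show ?thesis by (simp add: funpow_swap1)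
qed

lemma norm_J_An: "norm (J ((A ^^ n) (\<lambda>i. \<phi> i x))) \<le> norm x * (C * K * D)"
proof -
  have "\<bar>(A ^^ n) (\<lambda>i. \<phi> i x) i\<bar> \<le> K * (D * norm x)" for i
    by (rule A_bound) (rule phi_bound)
  then show ?thesis using J_bound[OF An_L[OF phi_L], of n x "K * (D * norm x)"]
    by (simp add: algebra_simps)
qed

lemma linear_T: "linear T"
  by (rule linearI) (simp_all add: T_def phi_add phi_scale A_add A_scale J_add J_scale A_L phi_L)

lemma bounded_linear_T: "bounded_linear T"
proof -
  have "norm (T x) \<le> norm x * (C * K * D)" for x
    using norm_J_An[of 1 x] by (simp add: T_def)
  then show ?thesis
    using linear_T unfolding bounded_linear_def bounded_linear_axioms_def by blast
qed

lemma positive_T: "positive_operator T"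
  unfolding positive_operator_def T_def by (auto intro!: J_pos A_pos phi_pos A_L phi_L)

lemma power_bounded_T: "power_bounded T"
  unfolding power_bounded_def
proof (rule bdd_aboveI2)
  fix n :: nat
  \<comment> \<open>The 1 covers power 0.\<close>
  let ?B = "max 1 (C * K * D)"
  show "onorm (T ^^ n) \<le> ?B"
  proof (rule onorm_bound)
    show "norm ((T ^^ n) x) \<le> ?B * norm x" for x
    proof (cases n)
      case 0
      then show ?thesis by (simp add: mult_le_cancel_right1)
    next
      case (Suc k)
      have "norm ((T ^^ n) x) \<le> (C * K * D) * norm x"
        using norm_J_An[of "Suc k" x] Tn[of k x] Suc by (simp add: mult.commute)
      also have "\<dots> \<le> ?B * norm x" by (intro mult_right_mono) auto
      finally show ?thesis .
    qed
  qed simp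
qed

lemma mean_ergodic_T: "mean_ergodic T"
  unfolding mean_ergodic_def
proof
  fix x :: 'a
  let ?a = "\<lambda>i. \<phi> i x"
  obtain b where b: "b \<in> L" and lim: "\<And>e. e > 0 \<Longrightarrow> \<forall>\<^sub>F N in sequentially.
      \<forall>i. \<bar>(1 / real N) * (\<Sum>n<N. (A ^^ n) ?a i) - b i\<bar> \<le> e"
    using A_mean[OF phi_L] by blast
  let ?m = "\<lambda>N. J (\<lambda>i. (1 / real N) * (\<Sum>n<N. (A ^^ n) ?a i))"
  have mL: "(\<lambda>i. (1 / real N) * (\<Sum>n<N. (A ^^ n) ?a i)) \<in> L" for N
    by (intro L_scale L_sum An_L phi_L)
  have "?m \<longlonglongrightarrow> J b"
  proof (rule tendstoI)
    fix e :: real assume e: "e > 0"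
    have "e / (C + 1) > 0" using e C_nonneg by simp
    from lim[OF this] show "\<forall>\<^sub>F N in sequentially. dist (?m N) (J b) < e"
    proof eventually_elim
      case (elim N)
      have "norm (?m N - J b) \<le> C * (e / (C + 1))"
        unfolding J_diff(2)[OF mL b, symmetric] using elim by (intro J_bound J_diff(1) mL b) auto
      also have "\<dots> < e" using e C_nonneg by (simp add: field_simps)
      finally show ?case by (simp add: dist_norm)
    qed
  qed
  \<comment> \<open>The summand for \<open>n = 0\<close> is \<open>x\<close> rather than
    \<open>J ?a\<close>; the discrepancy is a fixed vector divided by \<open>N\<close>.\<close>
  moreover have "(\<lambda>N. (1 / real N) *\<^sub>R (x - J ?a)) \<longlonglongrightarrow> 0"
    using tendsto_scaleR[OF lim_1_over_n[where 'a=real] tendsto_const, of "x - J ?a"] by simp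
  ultimately have "(\<lambda>N. ?m N + (1 / real N) *\<^sub>R (x - J ?a)) \<longlonglongrightarrow> J b"
    using tendsto_add by fastforce
  moreover have "?m N + (1 / real N) *\<^sub>R (x - J ?a) = (1 / real N) *\<^sub>R (\<Sum>n<N. (T ^^ n) x)" for N
  proof (cases N)
    case 0
    then show ?thesis by (simp add: J_zero)
  next
    case (Suc M)
    have "?m N = (1 / real N) *\<^sub>R J (\<lambda>i. \<Sum>n<N. (A ^^ n) ?a i)"
      by (intro J_scale L_sum An_L phi_L)
    also have "\<dots> = (1 / real N) *\<^sub>R (\<Sum>n<N. J ((A ^^ n) ?a))"
      by (simp add: J_sum An_L phi_L)
    also have "(\<Sum>n<N. J ((A ^^ n) ?a)) = J ?a + (\<Sum>n<M. (T ^^ Suc n) x)"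
      unfolding Suc sum.lessThan_Suc_shift Tn by simp
    also have "\<dots> = (\<Sum>n<N. (T ^^ n) x) - (x - J ?a)"
      unfolding Suc sum.lessThan_Suc_shift by simp
    finally show ?thesis by (simp add: scaleR_diff_right)
  qed
  ultimately show "convergent (\<lambda>n. (1 / real n) *\<^sub>R (\<Sum>k<n. (T ^^ k) x))"
    by (auto simp: convergent_def)
qed

text \<open>The times \<open>s\<close> are left free, so that each operator can use times along
  which its coordinates converge.\<close>

lemma weak_cluster_point_of_powers:
  assumes "weakly_almost_periodic T" "a \<in> L"
  shows "\<exists>y. \<forall>f l. bounded_linear f \<longrightarrow> (\<lambda>j. f (J ((A ^^ s j) a))) \<longlonglongrightarrow> (l::real) \<longrightarrow> f y = l"
proof -
  have K: "relatively_weakly_compact (range (\<lambda>n. (T ^^ n) (J a)))"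
    using assms(1) by (simp add: weakly_almost_periodic_def)
  have R: "J ((A ^^ s j) a) \<in> range (\<lambda>n. (T ^^ n) (J a))" for j
    using Tn_J[OF assms(2), of "s j"] by (metis rangeI)
  show ?thesis
    by (rule weak_cluster_functional[where z="\<lambda>j. J ((A ^^ s j) a)", OF K R]) blast
qed

end

section \<open>Banach limits and order bounded sequences\<close>

text \<open>\<open>p\<close> is the upper limit of \<open>\<phi> k x\<close> in \<open>k\<close>,
  written as the infimum of the eventual upper bounds. A linear functional below it agrees with the
  limit wherever that exists, by domination at \<open>x\<close> and at \<open>- x\<close>.\<close>

lemma banach_limit_functional:
  fixes \<phi> :: "nat \<Rightarrow> 'a::real_normed_vector \<Rightarrow> real"
  assumes lin: "\<And>k. linear (\<phi> k)" and bound: "\<And>k x. \<bar>\<phi> k x\<bar> \<le> D * norm x"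
  obtains f where "bounded_linear f" "\<And>x l. (\<lambda>k. \<phi> k x) \<longlonglongrightarrow> l \<Longrightarrow> f x = l"
proof -
  define P where "P x = {c. \<forall>\<^sub>F k in sequentially. \<phi> k x \<le> c}" for x
  define p where "p x = Inf (P x)" for x
  have low: "- (D * norm x) \<le> c" if "c \<in> P x" for x c
  proof -
    have "\<forall>\<^sub>F k in sequentially. \<phi> k x \<le> c" using that by (simp add: P_def)
    then obtain k where "\<phi> k x \<le> c" by (auto simp: eventually_sequentially)
    then show ?thesis using bound[of k x] by simp
  qed
  have mem: "D * norm x \<in> P x" for x
    using bound[of _ x] by (auto simp: P_def abs_le_iff)
  have bdd: "bdd_below (P x)" for x using low by (rule bdd_belowI)
  have p_le: "p x \<le> c" if "c \<in> P x" for x c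
    unfolding p_def by (rule cInf_lower[OF that bdd])
  have le_p: "c \<le> p x" if "\<And>d. d \<in> P x \<Longrightarrow> c \<le> d" for x c
    unfolding p_def using mem that by (intro cInf_greatest) auto
  have "p (x + y) \<le> p x + p y" for x y
  proof -
    have sum: "p (x + y) \<le> c + d" if "c \<in> P x" "d \<in> P y" for c d
    proof -
      have "\<forall>\<^sub>F k in sequentially. \<phi> k x \<le> c" "\<forall>\<^sub>F k in sequentially. \<phi> k y \<le> d"
        using that by (auto simp: P_def)
      then have "\<forall>\<^sub>F k in sequentially. \<phi> k (x + y) \<le> c + d"
        by eventually_elim (simp add: linear_add[OF lin] add_mono)
      then show ?thesis by (intro p_le) (simp add: P_def)
    qed
    have "p (x + y) - c \<le> p y" if "c \<in> P x" for c
      using sum[OF that] by (intro le_p) (simp add: diff_le_eq add.commute)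
    then have "p (x + y) - p y \<le> p x" by (intro le_p) (simp add: diff_le_eq add.commute)
    then show ?thesis by simp
  qed
  moreover have p0: "p 0 = 0"
    using p_le[OF mem, of 0] le_p[of 0 0] low[of _ 0] by force
  have hle: "p (c *\<^sub>R x) \<le> c * p x" if c: "0 < c" for c x
  proof -
    have "p (c *\<^sub>R x) / c \<le> p x"
    proof (rule le_p)
      fix d assume "d \<in> P x"
      then have "c * d \<in> P (c *\<^sub>R x)"
        using c by (simp add: P_def linear_scale[OF lin])
      then show "p (c *\<^sub>R x) / c \<le> d" using p_le c by (simp add: field_simps)
    qed
    then show ?thesis using c by (simp add: field_simps)
  qed
  have "p (c *\<^sub>R x) = c * p x" if "0 \<le> c" for c x
  proof (cases "c = 0")
    case False
    then have c: "c > 0" using that by simp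
    show ?thesis using hle[OF c, of x] hle[of "inverse c" "c *\<^sub>R x"] c by (simp add: field_simps)
  qed (simp add: p0)
  ultimately have "sublinear p" by (auto simp: sublinear_def)
  then obtain f where f: "linear f" "\<And>x. f x \<le> p x"
    using sublinear_dominates_linear by blast
  have "bounded_linear f"
  proof (rule bounded_linear_if_dominated[OF f(1)])
    show "f x \<le> D * norm x" for x using f(2)[of x] p_le[OF mem, of x] by simp
  qed
  moreover have le: "f x \<le> l" if "(\<lambda>k. \<phi> k x) \<longlonglongrightarrow> l" for x l
  proof (rule field_le_epsilon)
    fix e :: real assume "0 < e"
    then have "\<forall>\<^sub>F k in sequentially. \<phi> k x < l + e" using that by (intro order_tendstoD) auto
    then have "l + e \<in> P x" unfolding P_def by (auto elim: eventually_mono)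
    then show "f x \<le> l + e" using f(2)[of x] p_le by (meson order_trans)
  qed
  have "f x = l" if "(\<lambda>k. \<phi> k x) \<longlonglongrightarrow> l" for x l
  proof (rule antisym)
    have "(\<lambda>k. \<phi> k (- x)) \<longlonglongrightarrow> - l"
      using tendsto_minus[OF that] by (simp add: linear_neg[OF lin])
    then show "l \<le> f x" using le[of "- x" "- l"] linear_neg[OF f(1), of x] by simp
  qed (rule le[OF that])
  ultimately show thesis using that by blast
qed

section \<open>Suprema of sequences\<close>

definition is_lub :: "(nat \<Rightarrow> 'a::order) \<Rightarrow> 'a \<Rightarrow> bool" where
  "is_lub X s \<longleftrightarrow> (\<forall>n. X n \<le> s) \<and> (\<forall>t. (\<forall>n. X n \<le> t) \<longrightarrow> s \<le> t)"

lemma is_lubD: "is_lub X s \<Longrightarrow> X n \<le> s" "is_lub X s \<Longrightarrow> (\<And>n. X n \<le> t) \<Longrightarrow> s \<le> t"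
  by (auto simp: is_lub_def)

lemma is_lub_unique: "is_lub X s \<Longrightarrow> is_lub X t \<Longrightarrow> s = t"
  by (auto simp: is_lub_def intro: antisym)

lemma ex_is_lub:
  fixes X :: "nat \<Rightarrow> 'a::banach_lattice"
  assumes "countably_order_complete TYPE('a)" "\<And>n. 0 \<le> X n" "\<And>n. X n \<le> b"
  shows "\<exists>s. is_lub X s"
proof -
  have "range X \<noteq> {} \<and> countable (range X) \<and> bdd_below (range X) \<and> bdd_above (range X)"
    using assms(2,3) by (auto intro!: bdd_belowI[of _ 0] bdd_aboveI[of _ b])
  then obtain s where "isLub UNIV (range X) s"
    using assms(1) unfolding countably_order_complete_def by blast
  then have "is_lub X s"
    by (auto simp: is_lub_def isLub_def leastP_def isUb_def setle_def setge_def)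
  then show ?thesis ..
qed

text \<open>Monotonicity allows two indices to be replaced by their maximum, so the two suprema can
  be taken one after the other.\<close>

lemma is_lub_add:
  fixes X Y :: "nat \<Rightarrow> 'a::lattice_ab_group_add"
  assumes "is_lub X s" "is_lub Y t" "incseq X" "incseq Y"
  shows "is_lub (\<lambda>n. X n + Y n) (s + t)"
  unfolding is_lub_def
proof safe
  show "X n + Y n \<le> s + t" for n
    by (intro add_mono is_lubD(1) assms)
  fix b assume b: "\<forall>n. X n + Y n \<le> b"
  have "X n + Y m \<le> b" for n m
  proof -
    have "X n + Y m \<le> X (max n m) + Y (max n m)"
      using assms(3,4) by (intro add_mono) (auto simp: incseq_def)
    then show ?thesis using b by (meson order_trans)
  qed
  then have "s \<le> b - Y m" for m
    by (intro is_lubD(2)[OF assms(1)]) (simp add: le_diff_eq)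
  then have "t \<le> b - s"
    by (intro is_lubD(2)[OF assms(2)]) (simp add: le_diff_eq add.commute)
  then show "s + t \<le> b" by (simp add: le_diff_eq add.commute)
qed

lemma is_lub_scaleR:
  fixes X :: "nat \<Rightarrow> 'a::banach_lattice"
  assumes "is_lub X s" "0 \<le> c"
  shows "is_lub (\<lambda>n. c *\<^sub>R X n) (c *\<^sub>R s)"
proof (cases "c = 0")
  case True
  show ?thesis unfolding True is_lub_def by simp
next
  case False
  then have c: "c > 0" using assms by simp
  show ?thesis
    unfolding is_lub_def
  proof safe
    show "c *\<^sub>R X n \<le> c *\<^sub>R s" for n
      by (rule scaleR_left_mono[OF is_lubD(1)[OF assms(1)] assms(2)])
    fix t assume "\<forall>n. c *\<^sub>R X n \<le> t"
    then have "c *\<^sub>R X n \<le> c *\<^sub>R (inverse c *\<^sub>R t)" for n using c by simp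
    then have "s \<le> inverse c *\<^sub>R t"
      using c by (intro is_lubD(2)[OF assms(1)]) (simp only: scaleR_le_cancel_left_pos)
    then have "c *\<^sub>R s \<le> c *\<^sub>R (inverse c *\<^sub>R t)" using c by (simp only: scaleR_le_cancel_left_pos)
    then show "c *\<^sub>R s \<le> t" using c by simp
  qed
qed

text \<open>With \<open>d = inf s z\<close>, each \<open>X n\<close> is disjoint from
  \<open>d\<close>, so \<open>X n + d\<close> is the supremum of two elements below
  \<open>s\<close>. Hence \<open>s - d\<close> is already an upper bound and
  \<open>d = 0\<close>.\<close>

lemma is_lub_disjoint:
  fixes X :: "nat \<Rightarrow> 'a::lattice_ab_group_add"
  assumes "is_lub X s" "\<And>n. 0 \<le> X n" "0 \<le> z" "\<And>n. inf (X n) z = 0"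
  shows "inf s z = 0"
proof -
  let ?d = "inf s z"
  have s: "0 \<le> s" using assms(2)[of 0] is_lubD(1)[OF assms(1), of 0] by simp
  have "X n \<le> s - ?d" for n
  proof -
    have "inf (X n) ?d = 0"
      by (rule inf_le_disjoint[OF assms(2) order_refl _ inf_le2 assms(4)]) (use s assms(3) in simp)
    then have "X n + ?d = sup (X n) ?d" using add_eq_inf_sup[of "X n" ?d] by simp
    also have "\<dots> \<le> s" using is_lubD(1)[OF assms(1)] by (intro le_supI) auto
    finally show ?thesis by (simp only: le_diff_eq)
  qed
  then have "s \<le> s - ?d" by (rule is_lubD(2)[OF assms(1)])
  then have "s + ?d \<le> s + 0" by (simp only: le_diff_eq add_0_right)
  then have "?d \<le> 0" by (rule add_le_imp_le_left)
  then show ?thesis using s assms(3) by (intro antisym) auto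
qed

section \<open>Disjoint sequences from divergent order bounded ones\<close>

lemma nonconvergent_blocks:
  fixes X :: "nat \<Rightarrow> 'a::banach"
  assumes "\<not> convergent X"
  obtains d and p q :: "nat \<Rightarrow> nat" where "0 < d" "\<And>k. p k < q k" "\<And>j k. j < k \<Longrightarrow> q j \<le> p k"
    "\<And>k. d \<le> norm (X (p k) - X (q k))"
proof -
  have "\<not> Cauchy X" using assms by (simp add: Cauchy_convergent_iff)
  then obtain d where d: "d > 0" "\<And>N. \<exists>m\<ge>N. \<exists>n>m. d \<le> norm (X m - X n)"
    unfolding Cauchy_altdef dist_norm by (meson not_less)
  then obtain p q where pq: "\<And>N. N \<le> p N" "\<And>N. p N < q N" "\<And>N. d \<le> norm (X (p N) - X (q N))"
    by metis
  \<comment> \<open>Iterating \<open>q\<close> makes each block start at or after the end of the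
    previous one.\<close>
  define N where "N k = (q ^^ k) 0" for k
  have NSuc: "N (Suc k) = q (N k)" for k by (simp add: N_def)
  have "incseq N"
  proof (rule incseq_SucI)
    show "N k \<le> N (Suc k)" for k using pq(1)[of "N k"] pq(2)[of "N k"] by (simp add: NSuc)
  qed
  then have "q (N j) \<le> p (N k)" if "j < k" for j k
    using that pq(1)[of "N k"] incseqD[of N "Suc j" k] by (simp add: NSuc)
  then show thesis using d pq by (intro that[of d "\<lambda>k. p (N k)" "\<lambda>k. q (N k)"]) auto
qed

lemma order_bounded_disjoint_sequence:
  fixes X :: "nat \<Rightarrow> 'a::banach_lattice"
  assumes coc: "countably_order_complete TYPE('a)"
    and X: "\<And>n. 0 \<le> X n" "incseq X" "\<And>n. X n \<le> b" "\<not> convergent X"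
  obtains u :: "nat \<Rightarrow> 'a" and x d where "0 < d" "\<And>n. 0 \<le> u n" "\<And>n. u n \<le> x" "\<And>n. d \<le> norm (u n)"
    "\<And>m n. m \<noteq> n \<Longrightarrow> inf (u m) (u n) = 0"
proof -
  obtain s where s: "is_lub X s" using ex_is_lub[OF coc, of X b] X by blast
  define y where "y n = s - X n" for n
  have y0: "0 \<le> y n" for n using is_lubD(1)[OF s] by (simp add: y_def)
  have ydec: "y n \<le> y m" if "m \<le> n" for m n using X(2) that by (simp add: y_def incseq_def)
  \<comment> \<open>The norms of \<open>y\<close> decrease; if they came arbitrarily close to 0,
    then \<open>X\<close> would converge to \<open>s\<close>.\<close>
  have "\<exists>d>0. \<forall>n. d \<le> norm (y n)"
  proof (rule ccontr)
    assume "\<not> ?thesis"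
    then have small: "\<exists>n. norm (y n) < e" if "e > 0" for e using that by (meson not_le)
    have "X \<longlonglongrightarrow> s"
    proof (rule LIMSEQ_I)
      fix e :: real assume "e > 0"
      then obtain m where m: "norm (y m) < e" using small by blast
      have "norm (X n - s) < e" if "m \<le> n" for n
      proof -
        have "norm (X n - s) = norm (y n)" by (simp add: y_def norm_minus_commute)
        also have "\<dots> \<le> norm (y m)" by (intro norm_mono_pos y0 ydec that)
        finally show ?thesis using m by simp
      qed
      then show "\<exists>m. \<forall>n\<ge>m. norm (X n - s) < e" by blast
    qed
    then show False using X(4) by (auto simp: convergent_def)
  qed
  then obtain \<delta> where \<delta>: "\<delta> > 0" "\<And>n. \<delta> \<le> norm (y n)" by blast
  define x where "x = y 0"
  have x0: "0 \<le> x" by (simp add: x_def y0)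
  have yx: "y n \<le> x" for n by (simp add: x_def ydec)
  \<comment> \<open>Chosen so that removing \<open>\<epsilon> x\<close> costs at most half of
    \<open>\<delta>\<close> in norm; the added 1 keeps the denominator positive.\<close>
  define \<epsilon> where "\<epsilon> = \<delta> / (2 * (norm x + 1))"
  have nx: "norm x + 1 > 0" using norm_ge_zero[of x] by linarith
  have \<epsilon>: "\<epsilon> > 0" "\<epsilon> * norm x \<le> \<delta> / 2" using \<delta> nx by (auto simp: \<epsilon>_def field_simps)
  txt \<open>\<open>e n\<close> is the projection of \<open>x\<close> to the band generated by \<open>(y n - \<epsilon> x)\<^sup>+\<close>. Being components of
    \<open>x\<close>, the \<open>e n\<close> have disjoint successive differences, unlike the \<open>y n\<close>.\<close>
  define v where "v n = pprt (y n - \<epsilon> *\<^sub>R x)" for n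
  have v0: "0 \<le> v n" for n by (simp add: v_def)
  have vdec: "v n \<le> v m" if "m \<le> n" for m n
    unfolding v_def using that by (intro pprt_mono diff_right_mono ydec)
  have "\<exists>e. is_lub (\<lambda>k. inf x (real k *\<^sub>R v n)) e" for n
    by (rule ex_is_lub[OF coc, of _ x]) (use x0 v0 in auto)
  then obtain e where e: "\<And>n. is_lub (\<lambda>k. inf x (real k *\<^sub>R v n)) (e n)" by metis
  have le_e: "inf x (real k *\<^sub>R v n) \<le> e n" for k n by (rule is_lubD(1)[OF e])
  have e0: "0 \<le> e n" for n using le_e[of 0 n] x0 by (simp add: inf_absorb2)
  have ex: "e n \<le> x" for n by (rule is_lubD(2)[OF e]) simp
  have edec: "e n \<le> e m" if "m \<le> n" for m n
  proof (rule is_lubD(2)[OF e])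
    fix k
    have "inf x (real k *\<^sub>R v n) \<le> inf x (real k *\<^sub>R v m)"
      by (intro inf_mono scaleR_left_mono vdec that) auto
    then show "inf x (real k *\<^sub>R v n) \<le> e m" using le_e order_trans by blast
  qed
  \<comment> \<open>Let \<open>d\<close> be the infimum of \<open>x - e n\<close> and
    \<open>v n\<close>. Adding \<open>d\<close> to \<open>inf x (k v n)\<close> stays below
    \<open>inf x ((k + 1) v n)\<close>, so \<open>e n - d\<close> is an upper bound too and
    \<open>d\<close> vanishes.\<close>
  have comp: "inf (x - e n) (e n) = 0" for n
  proof -
    let ?d = "inf (x - e n) (v n)"
    have d0: "0 \<le> ?d" using ex v0 by simp
    have "e n \<le> e n - ?d"
    proof (rule is_lubD(2)[OF e])
      fix k
      let ?i = "inf x (real k *\<^sub>R v n)"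
      have "?i + ?d \<le> e n + (x - e n)" by (intro add_mono le_e) simp
      moreover have "?i + ?d \<le> real k *\<^sub>R v n + v n" by (intro add_mono) auto
      ultimately have "?i + ?d \<le> inf x (real (Suc k) *\<^sub>R v n)"
        by (simp add: scaleR_add_left add.commute)
      then have "?i + ?d \<le> e n" using le_e order_trans by blast
      then show "?i \<le> e n - ?d" by (simp only: le_diff_eq)
    qed
    then have "e n + ?d \<le> e n + 0" by (simp only: le_diff_eq add_0_right)
    then have "?d \<le> 0" by (rule add_le_imp_le_left)
    then have disj: "?d = 0" using d0 by (rule antisym)
    have "inf (e n) (x - e n) = 0"
    proof (rule is_lub_disjoint[OF e])
      show "inf (inf x (real k *\<^sub>R v n)) (x - e n) = 0" for k
      proof (rule inf_le_disjoint[OF _ inf_le2 _ order_refl])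
        show "inf (real k *\<^sub>R v n) (x - e n) = 0"
          using inf_scaleR_disjoint[of "v n" "x - e n" "real k" 1] disj v0 ex by (simp add: inf_commute)
      qed (use x0 v0 ex in auto)
    qed (use x0 v0 ex in auto)
    then show ?thesis by (simp add: inf_commute)
  qed
  have y_le: "y n \<le> e n + \<epsilon> *\<^sub>R x" for n
  proof -
    have "v n \<le> x"
      unfolding v_def pprt_def using yx[of n] x0 \<epsilon>
      by (intro le_supI) (auto intro: order_trans[of _ "y n"])
    then have "v n \<le> e n" using le_e[of 1 n] by (simp add: inf_absorb2)
    moreover have "y n - \<epsilon> *\<^sub>R x \<le> v n" by (simp add: v_def pprt_def)
    ultimately have "y n - \<epsilon> *\<^sub>R x \<le> e n" by (rule order_trans[rotated])
    then show ?thesis by (simp add: diff_le_eq)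
  qed
  \<comment> \<open>\<open>\<epsilon> x\<close> is at most \<open>y n\<close> plus the negative part
    of \<open>y n - \<epsilon> x\<close>, and that part is disjoint from \<open>v n\<close>.\<close>
  have e_le: "\<epsilon> *\<^sub>R e n \<le> y n" for n
  proof (rule is_lubD(2)[OF is_lub_scaleR[OF e]])
    fix k
    let ?w = "y n - \<epsilon> *\<^sub>R x"
    have "\<epsilon> *\<^sub>R inf x (real k *\<^sub>R v n) = inf (\<epsilon> *\<^sub>R x) ((\<epsilon> * real k) *\<^sub>R v n)"
      using \<epsilon> by (simp add: inf_scaleR)
    also have "\<dots> \<le> inf (y n + pprt (- ?w)) ((\<epsilon> * real k) *\<^sub>R v n)"
    proof (rule inf_mono)
      have "- ?w \<le> pprt (- ?w)" by (simp add: pprt_def)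
      then show "\<epsilon> *\<^sub>R x \<le> y n + pprt (- ?w)" by (simp add: diff_le_eq add.commute)
    qed simp
    also have "\<dots> \<le> inf (y n) ((\<epsilon> * real k) *\<^sub>R v n) + inf (pprt (- ?w)) ((\<epsilon> * real k) *\<^sub>R v n)"
      using \<epsilon> v0 y0 by (intro inf_add_le) auto
    also have "inf (pprt (- ?w)) ((\<epsilon> * real k) *\<^sub>R v n) = 0"
      using inf_scaleR_disjoint[of "pprt (- ?w)" "v n" 1 "\<epsilon> * real k"] \<epsilon> inf_pprt_disjoint[of ?w] v0
      by (simp add: v_def inf_commute)
    finally show "\<epsilon> *\<^sub>R inf x (real k *\<^sub>R v n) \<le> y n" by simp
  qed (use \<epsilon> in simp)
  have norm_e: "\<delta> / 2 \<le> norm (e n)" for n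
  proof -
    have "norm (y n) \<le> norm (e n + \<epsilon> *\<^sub>R x)" by (intro norm_mono_pos y0 y_le)
    also have "\<dots> \<le> norm (e n) + \<epsilon> * norm x"
      using norm_triangle_ineq[of "e n" "\<epsilon> *\<^sub>R x"] \<epsilon> by simp
    finally show ?thesis using \<delta>(2)[of n] \<epsilon> by linarith
  qed
  \<comment> \<open>A limit \<open>l\<close> would lie below all \<open>e n\<close>, hence
    \<open>\<epsilon> l\<close> below all \<open>s - X n\<close>. Since \<open>s\<close> is the
    least upper bound, \<open>l = 0\<close>, against \<open>norm_e\<close>.\<close>
  have "\<not> convergent e"
  proof
    assume "convergent e"
    then obtain l where l: "e \<longlonglongrightarrow> l" by (auto simp: convergent_def)
    have l0: "0 \<le> l" by (rule tendsto_nonneg_lattice[OF l]) (simp add: e0)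
    have "l \<le> e n" for n
    proof -
      have "(\<lambda>m. e n - e m) \<longlonglongrightarrow> e n - l" by (intro tendsto_intros l)
      then have "0 \<le> e n - l"
        by (rule tendsto_nonneg_lattice) (auto simp: eventually_sequentially intro!: exI[of _ n] edec)
      then show ?thesis by simp
    qed
    then have "\<epsilon> *\<^sub>R l \<le> s - X n" for n
      using scaleR_left_mono[of l "e n" \<epsilon>] e_le[of n] \<epsilon> unfolding y_def by (meson order_trans less_imp_le)
    then have "X n \<le> s - \<epsilon> *\<^sub>R l" for n
      by (simp add: le_diff_eq add.commute)
    then have "s \<le> s - \<epsilon> *\<^sub>R l" by (rule is_lubD(2)[OF s])
    then have "\<epsilon> *\<^sub>R l \<le> \<epsilon> *\<^sub>R 0" by simp
    then have "l \<le> 0" using \<epsilon>(1) by (simp only: scaleR_le_cancel_left_pos)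
    then have "l = 0" using l0 by simp
    then have "(\<lambda>n. norm (e n)) \<longlonglongrightarrow> 0" using l by (simp add: tendsto_norm_zero)
    then have "\<delta> / 2 \<le> 0" by (rule tendsto_lowerbound) (use norm_e in auto)
    then show False using \<delta> by simp
  qed
  then obtain d and p q :: "nat \<Rightarrow> nat" where d: "0 < d" and pq: "\<And>k. p k < q k" "\<And>j k. j < k \<Longrightarrow> q j \<le> p k"
    "\<And>k. d \<le> norm (e (p k) - e (q k))"
    using nonconvergent_blocks[of e] by metis
  define u where "u k = e (p k) - e (q k)" for k
  have u0: "0 \<le> u k" for k using edec[of "p k" "q k"] pq(1)[of k] by (simp add: u_def)
  \<comment> \<open>For \<open>j < k\<close>, \<open>u j\<close> lies below the complement
    \<open>x - e (q j)\<close> and \<open>u k\<close> below the component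
    \<open>e (q j)\<close>.\<close>
  have uu: "inf (u j) (u k) = 0" if "j < k" for j k
  proof (rule inf_le_disjoint[OF u0 _ u0 _ comp])
    show "u j \<le> x - e (q j)" using ex by (simp add: u_def)
    have "e (p k) \<le> e (q j)" by (rule edec[OF pq(2)[OF that]])
    moreover have "u k \<le> e (p k)" using e0 by (simp add: u_def)
    ultimately show "u k \<le> e (q j)" by (rule order_trans[rotated])
  qed
  show thesis
  proof (rule that[of d u x])
    show "u n \<le> x" for n
      using ex[of "p n"] e0[of "q n"] unfolding u_def
      by (meson add_increasing2 diff_le_eq order_trans)
    show "inf (u m) (u n) = 0" if "m \<noteq> n" for m n
      using uu[of m n] uu[of n m] that by (cases "m < n") (auto simp: inf_commute)
    show "d \<le> norm (u n)" for n using pq(3)[of n] by (simp add: u_def)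
  qed (use d u0 in auto)
qed

text \<open>The individual constants \<open>norm (u i)\<close> are replaced by their common lower
  bound \<open>d\<close>, which makes all estimates uniform in \<open>i\<close>.\<close>

lemma biorthogonal_functionals:
  fixes u :: "'i \<Rightarrow> 'a::banach_lattice"
  assumes d: "0 < d" and u: "\<And>i. 0 \<le> u i" "\<And>i. d \<le> norm (u i)"
  obtains \<phi> :: "'i \<Rightarrow> 'a \<Rightarrow> real" where "\<And>i. linear (\<phi> i)" "\<And>i x. 0 \<le> x \<Longrightarrow> 0 \<le> \<phi> i x"
    "\<And>i. \<phi> i (u i) = 1" "\<And>i x. \<bar>\<phi> i x\<bar> \<le> (1 / d) * norm x"
    "\<And>i x. 0 \<le> x \<Longrightarrow> inf x (u i) = 0 \<Longrightarrow> \<phi> i x = 0"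
    "\<And>i x e. 0 \<le> x \<Longrightarrow> 0 < e \<Longrightarrow> \<exists>k\<ge>0. d * \<phi> i x \<le> norm (inf x (k *\<^sub>R u i)) + e"
proof -
  have "\<exists>f. linear f \<and> (\<forall>x\<ge>0. 0 \<le> f x) \<and> f (u i) = 1 \<and> (\<forall>x. \<bar>f x\<bar> \<le> (1 / d) * norm x)
      \<and> (\<forall>x\<ge>0. inf x (u i) = 0 \<longrightarrow> f x = 0)
      \<and> (\<forall>x\<ge>0. \<forall>e>0. \<exists>k\<ge>0. d * f x \<le> norm (inf x (k *\<^sub>R u i)) + e)" for i
  proof -
    have nu: "norm (u i) > 0" using d u(2)[of i] by linarith
    then have ne: "u i \<noteq> 0" by auto
    obtain f where f: "linear f" "\<And>x. 0 \<le> x \<Longrightarrow> 0 \<le> f x" "f (u i) = 1"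
      "\<And>x. \<bar>f x\<bar> \<le> norm x / norm (u i)" "\<And>x. 0 \<le> x \<Longrightarrow> inf x (u i) = 0 \<Longrightarrow> f x = 0"
      "\<And>x e. 0 \<le> x \<Longrightarrow> 0 < e \<Longrightarrow> \<exists>k\<ge>0. norm (u i) * f x \<le> norm (inf x (k *\<^sub>R u i)) + e"
      by (rule disjoint_functional[OF u(1) ne]) blast
    have "\<bar>f x\<bar> \<le> (1 / d) * norm x" for x
    proof -
      have "norm x / norm (u i) \<le> norm x / d"
        using d u(2)[of i] nu by (intro divide_left_mono mult_pos_pos) auto
      then show ?thesis using f(4)[of x] by simp
    qed
    moreover have "\<exists>k\<ge>0. d * f x \<le> norm (inf x (k *\<^sub>R u i)) + e" if x: "0 \<le> x" "0 < e" for x e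
    proof -
      have "d * f x \<le> norm (u i) * f x" using u(2)[of i] f(2)[OF x(1)] by (rule mult_right_mono)
      then show ?thesis using f(6)[OF x] by force
    qed
    ultimately show ?thesis using f by blast
  qed
  then obtain \<phi> where "\<forall>i. linear (\<phi> i) \<and> (\<forall>x\<ge>0. 0 \<le> \<phi> i x) \<and> \<phi> i (u i) = 1
      \<and> (\<forall>x. \<bar>\<phi> i x\<bar> \<le> (1 / d) * norm x) \<and> (\<forall>x\<ge>0. inf x (u i) = 0 \<longrightarrow> \<phi> i x = 0)
      \<and> (\<forall>x\<ge>0. \<forall>e>0. \<exists>k\<ge>0. d * \<phi> i x \<le> norm (inf x (k *\<^sub>R u i)) + e)"
    by metis
  then show thesis by (intro that[of \<phi>]) auto
qed

section \<open>A positively complemented copy of the bounded sequences\<close>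

locale order_bounded_disjoint =
  fixes u :: "nat \<Rightarrow> 'a::banach_lattice" and x :: 'a
  assumes coc: "countably_order_complete TYPE('a)"
    and u_nonneg: "0 \<le> u n" and u_le: "u n \<le> x"
    and u_disjoint: "m \<noteq> n \<Longrightarrow> inf (u m) (u n) = 0"
begin

definition linf :: "(nat \<Rightarrow> real) set" where
  "linf = {a. \<exists>c. \<forall>n. \<bar>a n\<bar> \<le> c}"

definition S :: "(nat \<Rightarrow> real) \<Rightarrow> nat \<Rightarrow> 'a" where
  "S a N = (\<Sum>n<N. a n *\<^sub>R u n)"

text \<open>The series of the \<open>a n u n\<close> may diverge in norm, so its sum is the supremum
  of the partial sums. That needs nonnegative coefficients; \<open>J\<close> extends it by
  differences.\<close>

definition P :: "(nat \<Rightarrow> real) \<Rightarrow> 'a" where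
  "P a = (SOME s. is_lub (S a) s)"

definition J :: "(nat \<Rightarrow> real) \<Rightarrow> 'a" where
  "J a = P (\<lambda>n. max (a n) 0) - P (\<lambda>n. max (- a n) 0)"

definition linf_pos :: "(nat \<Rightarrow> real) set" where
  "linf_pos = {a \<in> linf. \<forall>n. 0 \<le> a n}"

lemma linf_add: "a \<in> linf \<Longrightarrow> b \<in> linf \<Longrightarrow> (\<lambda>n. a n + b n) \<in> linf"
  unfolding linf_def by clarsimp (meson abs_triangle_ineq add_mono order_trans)

lemma linf_scale:
  assumes "a \<in> linf"
  shows "(\<lambda>n. c * a n) \<in> linf"
proof -
  obtain b where "\<And>n. \<bar>a n\<bar> \<le> b" using assms by (auto simp: linf_def)
  then have "\<bar>c * a n\<bar> \<le> \<bar>c\<bar> * b" for n by (simp add: abs_mult mult_left_mono)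
  then show ?thesis by (auto simp: linf_def)
qed

lemma linf_pos_add: "a \<in> linf_pos \<Longrightarrow> b \<in> linf_pos \<Longrightarrow> (\<lambda>n. a n + b n) \<in> linf_pos"
  by (auto simp: linf_pos_def linf_add)

lemma linf_pos_scale: "a \<in> linf_pos \<Longrightarrow> 0 \<le> c \<Longrightarrow> (\<lambda>n. c * a n) \<in> linf_pos"
  by (auto simp: linf_pos_def linf_scale)

lemma linf_pos_part:
  assumes "a \<in> linf"
  shows "(\<lambda>n. max (a n) 0) \<in> linf_pos" "(\<lambda>n. max (- a n) 0) \<in> linf_pos"
proof -
  obtain c where c: "\<And>n. \<bar>a n\<bar> \<le> c" using assms by (auto simp: linf_def)
  have "\<bar>max (a n) 0\<bar> \<le> c" "\<bar>max (- a n) 0\<bar> \<le> c" for n using c[of n] by auto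
  then show "(\<lambda>n. max (a n) 0) \<in> linf_pos" "(\<lambda>n. max (- a n) 0) \<in> linf_pos"
    by (auto simp: linf_pos_def linf_def)
qed

lemma S_nonneg: "a \<in> linf_pos \<Longrightarrow> 0 \<le> S a N"
  by (auto simp: S_def linf_pos_def u_nonneg intro!: sum_nonneg)

lemma S_incseq: "a \<in> linf_pos \<Longrightarrow> incseq (S a)"
  by (rule incseq_SucI) (simp add: S_def linf_pos_def u_nonneg)

lemma S_le:
  assumes "\<And>n. 0 \<le> a n" "\<And>n. a n \<le> c"
  shows "S a N \<le> c *\<^sub>R x"
proof -
  have c: "0 \<le> c" using assms[of 0] by linarith
  have "S a N \<le> (\<Sum>n<N. c *\<^sub>R u n)"
    unfolding S_def using assms u_nonneg by (intro sum_mono scaleR_right_mono)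
  also have "\<dots> = c *\<^sub>R (\<Sum>n<N. u n)" by (simp add: scaleR_sum_right)
  also have "\<dots> \<le> c *\<^sub>R x"
  proof (rule scaleR_left_mono[OF _ c])
    show "(\<Sum>n<N. u n) \<le> x"
      by (rule sum_disjoint_le) (use u_nonneg u_le u_disjoint order_trans in blast)+
  qed
  finally show ?thesis .
qed

lemma P_lub:
  assumes "a \<in> linf_pos"
  shows "is_lub (S a) (P a)"
proof -
  obtain c where c: "\<forall>n. \<bar>a n\<bar> \<le> c" using assms unfolding linf_pos_def linf_def by blast
  have "S a N \<le> c *\<^sub>R x" for N
  proof (rule S_le)
    show "0 \<le> a n" for n using assms by (simp add: linf_pos_def)
    show "a n \<le> c" for n using c abs_ge_self[of "a n"] by (meson order_trans)
  qed
  then have "\<exists>s. is_lub (S a) s"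
    using S_nonneg[OF assms] by (intro ex_is_lub[OF coc])
  then show ?thesis unfolding P_def by (rule someI_ex)
qed

lemma P_eqI: "a \<in> linf_pos \<Longrightarrow> is_lub (S a) s \<Longrightarrow> P a = s"
  using P_lub is_lub_unique by blast

lemma P_add:
  assumes "a \<in> linf_pos" "b \<in> linf_pos"
  shows "P (\<lambda>n. a n + b n) = P a + P b"
proof (rule P_eqI[OF linf_pos_add[OF assms]])
  have "S (\<lambda>n. a n + b n) = (\<lambda>N. S a N + S b N)"
    by (auto simp: S_def scaleR_add_left sum.distrib)
  then show "is_lub (S (\<lambda>n. a n + b n)) (P a + P b)"
    using is_lub_add[OF P_lub P_lub S_incseq S_incseq] assms by simp
qed

lemma P_scale:
  assumes "a \<in> linf_pos" "0 \<le> c"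
  shows "P (\<lambda>n. c * a n) = c *\<^sub>R P a"
proof (rule P_eqI[OF linf_pos_scale[OF assms]])
  have "S (\<lambda>n. c * a n) = (\<lambda>N. c *\<^sub>R S a N)"
    by (auto simp: S_def scaleR_sum_right)
  then show "is_lub (S (\<lambda>n. c * a n)) (c *\<^sub>R P a)"
    using is_lub_scaleR[OF P_lub assms(2)] assms by simp
qed

lemma P_nonneg: "a \<in> linf_pos \<Longrightarrow> 0 \<le> P a"
  using is_lubD(1)[OF P_lub, of a 0] by (simp add: S_def)

lemma P_single:
  assumes "0 \<le> c"
  shows "(\<lambda>n. if n = m then c else 0) \<in> linf_pos" "P (\<lambda>n. if n = m then c else 0) = c *\<^sub>R u m"
proof -
  show L: "(\<lambda>n. if n = m then c else 0) \<in> linf_pos"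
    using assms by (auto simp: linf_pos_def linf_def intro!: exI[of _ c])
  have "S (\<lambda>n. if n = m then c else 0) N = (if m < N then c *\<^sub>R u m else 0)" for N
    by (simp add: S_def if_distrib[of "\<lambda>t. t *\<^sub>R _"] sum.delta' cong: if_cong)
  then show "P (\<lambda>n. if n = m then c else 0) = c *\<^sub>R u m"
    using assms u_nonneg[of m] by (intro P_eqI[OF L]) (auto simp: is_lub_def dest: spec[of _ "Suc m"])
qed

text \<open>Any splitting into nonnegative bounded parts computes \<open>J\<close>: cross-adding it
  with the canonical splitting gives two equal sums, on which \<open>P\<close> is additive.
  Linearity of \<open>J\<close> reduces to this.\<close>

lemma J_diff_pos:
  assumes "b \<in> linf_pos" "c \<in> linf_pos"
  shows "J (\<lambda>n. b n - c n) = P b - P c"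
proof -
  let ?a = "\<lambda>n. b n - c n"
  have "?a \<in> linf"
    using assms linf_add[OF _ linf_scale[of c "-1"]] by (auto simp: linf_pos_def)
  note p = linf_pos_part[OF this]
  have "P (\<lambda>n. max (?a n) 0 + c n) = P (\<lambda>n. b n + max (- ?a n) 0)"
    by (rule arg_cong[where f=P]) (auto simp: max_def)
  then have "P (\<lambda>n. max (?a n) 0) + P c = P b + P (\<lambda>n. max (- ?a n) 0)"
    using P_add[OF p(1) assms(2)] P_add[OF assms(1) p(2)] by simp
  then show ?thesis unfolding J_def by (simp add: algebra_simps)
qed

lemma decompose:
  assumes "a \<in> linf"
  obtains b c where "b \<in> linf_pos" "c \<in> linf_pos" "a = (\<lambda>n. b n - c n)" "J a = P b - P c"
    "\<forall>n. \<bar>a n\<bar> = b n + c n"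
proof (rule that[OF linf_pos_part[OF assms]])
  show "a = (\<lambda>n. max (a n) 0 - max (- a n) 0)" by (auto simp: max_def)
qed (auto simp: J_def max_def)

lemma J_add:
  assumes "a \<in> linf" "a' \<in> linf"
  shows "J (\<lambda>n. a n + a' n) = J a + J a'"
proof -
  obtain b c where bc: "b \<in> linf_pos" "c \<in> linf_pos" "a = (\<lambda>n. b n - c n)" "J a = P b - P c"
    by (rule decompose[OF assms(1)])
  obtain b' c' where bc': "b' \<in> linf_pos" "c' \<in> linf_pos" "a' = (\<lambda>n. b' n - c' n)" "J a' = P b' - P c'"
    by (rule decompose[OF assms(2)])
  have "(\<lambda>n. a n + a' n) = (\<lambda>n. (b n + b' n) - (c n + c' n))" using bc bc' by auto
  then have "J (\<lambda>n. a n + a' n) = P (\<lambda>n. b n + b' n) - P (\<lambda>n. c n + c' n)"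
    using J_diff_pos[OF linf_pos_add[OF bc(1) bc'(1)] linf_pos_add[OF bc(2) bc'(2)]] by simp
  then show ?thesis using bc bc' by (simp add: P_add)
qed

lemma J_scale:
  assumes "a \<in> linf"
  shows "J (\<lambda>n. r * a n) = r *\<^sub>R J a"
proof -
  obtain b c where bc: "b \<in> linf_pos" "c \<in> linf_pos" "a = (\<lambda>n. b n - c n)" "J a = P b - P c"
    by (rule decompose[OF assms])
  show ?thesis
  proof (cases "0 \<le> r")
    case True
    have "(\<lambda>n. r * a n) = (\<lambda>n. r * b n - r * c n)" using bc by (auto simp: algebra_simps)
    then have "J (\<lambda>n. r * a n) = P (\<lambda>n. r * b n) - P (\<lambda>n. r * c n)"
      using J_diff_pos linf_pos_scale True bc by simp
    then show ?thesis using bc True by (simp add: P_scale scaleR_diff_right)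
  next
    case False
    have "(\<lambda>n. r * a n) = (\<lambda>n. - r * c n - - r * b n)" using bc by (auto simp: algebra_simps)
    then have "J (\<lambda>n. r * a n) = P (\<lambda>n. - r * c n) - P (\<lambda>n. - r * b n)"
      using J_diff_pos[of "\<lambda>n. - r * c n" "\<lambda>n. - r * b n"] linf_pos_scale[of _ "- r"] False bc by simp
    then show ?thesis using bc False P_scale[of b "- r"] P_scale[of c "- r"]
      by (simp add: scaleR_diff_right)
  qed
qed

lemma J_eq_P:
  assumes "a \<in> linf_pos"
  shows "J a = P a"
proof -
  have "P (\<lambda>n. 0) = 0" using P_single[of 0] by simp
  moreover have "(\<lambda>n. 0) \<in> linf_pos" using P_single(1)[of 0] by simp
  ultimately show ?thesis using J_diff_pos[OF assms, of "\<lambda>n. 0"] by simp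
qed

text \<open>\<open>\<bar>J a\<bar>\<close> is at most the order sum of the
  \<open>\<bar>a n\<bar> u n\<close>, which lies below \<open>c x\<close> because the partial sums
  of the disjoint \<open>u n\<close> lie below \<open>x\<close>.\<close>

lemma J_bound:
  assumes "a \<in> linf" "\<And>n. \<bar>a n\<bar> \<le> c"
  shows "norm (J a) \<le> norm x * c"
proof -
  obtain p q where pq: "p \<in> linf_pos" "q \<in> linf_pos" "a = (\<lambda>n. p n - q n)" "J a = P p - P q"
    "\<forall>n. \<bar>a n\<bar> = p n + q n" by (rule decompose[OF assms(1)])
  have x0: "0 \<le> x" using u_nonneg u_le order_trans by blast
  have c0: "0 \<le> c" using assms(2)[of 0] by linarith
  have "\<bar>J a\<bar> \<le> \<bar>P p\<bar> + \<bar>P q\<bar>"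
    unfolding pq(4) using abs_triangle_ineq4 by blast
  also have "\<dots> = P (\<lambda>n. p n + q n)" using P_nonneg pq(1,2) by (simp add: P_add)
  also have "\<dots> \<le> c *\<^sub>R x"
    using assms(2) pq(5) linf_pos_add[OF pq(1,2)]
    by (intro is_lubD(2)[OF P_lub] S_le) (auto simp: linf_pos_def)
  finally have "norm (J a) \<le> norm (c *\<^sub>R x)"
    using x0 c0 by (intro norm_mono_abs) simp
  then show ?thesis using c0 by (simp add: mult.commute)
qed

lemma P_disjoint:
  assumes "a \<in> linf_pos" "a m = 0"
  shows "inf (P a) (u m) = 0"
proof (rule is_lub_disjoint[OF P_lub[OF assms(1)] S_nonneg[OF assms(1)] u_nonneg])
  fix N
  show "inf (S a N) (u m) = 0"
    unfolding S_def
  proof (rule inf_sum_disjoint[OF _ u_nonneg])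
    show "0 \<le> a n *\<^sub>R u n" for n using assms u_nonneg by (simp add: linf_pos_def)
    show "inf (a n *\<^sub>R u n) (u m) = 0" for n
    proof (cases "n = m")
      case True
      then show ?thesis using assms u_nonneg by (simp add: inf_absorb1)
    next
      case False
      then show ?thesis
        using inf_scaleR_disjoint[of "u n" "u m" "a n" 1] assms u_nonneg u_disjoint
        by (simp add: linf_pos_def)
    qed
  qed
qed

lemma sequence_copy_linf:
  assumes lin: "\<And>i. linear (\<phi> i)" and pos: "\<And>i y. 0 \<le> y \<Longrightarrow> 0 \<le> \<phi> i y"
    and one: "\<And>i. \<phi> i (u i) = 1" and bound: "\<And>i y. \<bar>\<phi> i y\<bar> \<le> D * norm y"
    and disj: "\<And>i y. 0 \<le> y \<Longrightarrow> inf y (u i) = 0 \<Longrightarrow> \<phi> i y = 0"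
  shows "sequence_copy linf J \<phi> (norm x) D"
proof (rule sequence_copy.intro)
  show "(\<lambda>i. \<phi> i y) \<in> linf" for y using bound by (auto simp: linf_def)
  \<comment> \<open>\<open>\<phi> i\<close> need not be order continuous, so it is not evaluated
    term by term: the \<open>i\<close>-th term is split off, and the rest is disjoint from
    \<open>u i\<close>.\<close>
  have P: "\<phi> i (P a) = a i" if a: "a \<in> linf_pos" for a i
  proof -
    let ?b = "\<lambda>n. if n = i then 0 else a n"
    let ?s = "\<lambda>n. if n = i then a i else 0"
    obtain c where c: "\<forall>n. \<bar>a n\<bar> \<le> c" using a unfolding linf_pos_def linf_def by blast
    have "\<bar>?b n\<bar> \<le> \<bar>c\<bar>" for n using c[rule_format, of n] by auto
    then have "?b \<in> linf" unfolding linf_def by blast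
    then have b: "?b \<in> linf_pos" using a by (simp add: linf_pos_def)
    have s: "?s \<in> linf_pos" "P ?s = a i *\<^sub>R u i" using a P_single by (auto simp: linf_pos_def)
    have "a = (\<lambda>n. ?s n + ?b n)" by auto
    then have "P a = a i *\<^sub>R u i + P ?b" using P_add[OF s(1) b] s(2) by simp
    moreover have "\<phi> i (P ?b) = 0" using disj P_nonneg[OF b] P_disjoint[OF b] by simp
    ultimately show ?thesis using one linear_add[OF lin] linear_scale[OF lin] by simp
  qed
  show "\<phi> i (J a) = a i" if aL: "a \<in> linf" for a i
  proof -
    obtain b c where bc: "b \<in> linf_pos" "c \<in> linf_pos" "a = (\<lambda>n. b n - c n)" "J a = P b - P c"
      by (rule decompose[OF aL])
    then show ?thesis using P linear_diff[OF lin] by simp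
  qed
  show "0 \<le> J a" if "a \<in> linf" "\<And>i. 0 \<le> a i" for a
    using that J_eq_P P_nonneg by (simp add: linf_pos_def)
qed (fact linf_add linf_scale J_add J_scale J_bound lin pos bound)+

end

section \<open>The operator on a copy of bounded sequences\<close>

text \<open>The coordinates \<open>2k\<close> and \<open>2k + 1\<close> carry the \<open>k\<close>-th matrix, whose second eigenvalue is \<open>rate\<close>.\<close>

definition partner :: "nat \<Rightarrow> nat" where
  "partner n = (if even n then Suc n else n - 1)"

definition rate :: "nat \<Rightarrow> real" where
  "rate n = 1 / real (n div 2 + 1) - 1"

definition swap_op :: "(nat \<Rightarrow> real) \<Rightarrow> nat \<Rightarrow> real" where
  "swap_op a n = (1 + rate n) / 2 * a n + (1 - rate n) / 2 * a (partner n)"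

lemma partner_partner [simp]: "partner (partner n) = n"
  by (auto simp: partner_def)

lemma rate_partner [simp]: "rate (partner n) = rate n"
  by (auto simp: partner_def rate_def elim!: evenE oddE)

lemma rate_bounds: "-1 < rate n" "rate n \<le> 0"
  by (auto simp: rate_def divide_simps)

text \<open>On each pair of coordinates the average is fixed and the half difference is multiplied
  by \<open>rate n\<close>.\<close>

lemma swap_op_funpow:
  "(swap_op ^^ k) a n = (a n + a (partner n)) / 2 + rate n ^ k * ((a n - a (partner n)) / 2)"
proof (induction k arbitrary: n)
  case (Suc k)
  define t where "t = (a n - a (partner n)) / 2"
  define s where "s = (a n + a (partner n)) / 2"
  have "(swap_op ^^ k) a n = s + rate n ^ k * t"
    by (simp add: Suc s_def t_def)
  moreover have "(swap_op ^^ k) a (partner n) = s - rate n ^ k * t"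
    by (simp add: Suc s_def t_def field_simps)
  ultimately have "(swap_op ^^ Suc k) a n
      = (1 + rate n) / 2 * (s + rate n ^ k * t) + (1 - rate n) / 2 * (s - rate n ^ k * t)"
    by (simp only: swap_op_def[of "(swap_op ^^ k) a"] funpow.simps comp_apply)
  also have "\<dots> = s + rate n ^ Suc k * t" by (simp add: field_simps)
  finally have "(swap_op ^^ Suc k) a n = s + rate n ^ Suc k * t" .
  then show ?case by (simp add: s_def t_def)
qed (simp add: field_simps)

text \<open>Each row of the matrix has nonnegative entries with sum 1.\<close>

lemma swap_op_bound:
  assumes "\<And>n. \<bar>a n\<bar> \<le> c"
  shows "\<bar>(swap_op ^^ k) a n\<bar> \<le> c"
proof (induction k arbitrary: n)
  case 0
  then show ?case using assms by simp
next
  case (Suc k)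
  have r: "0 \<le> (1 + rate n) / 2" "0 \<le> (1 - rate n) / 2" using rate_bounds[of n] by auto
  have "\<bar>(swap_op ^^ Suc k) a n\<bar> \<le> (1 + rate n) / 2 * \<bar>(swap_op ^^ k) a n\<bar>
      + (1 - rate n) / 2 * \<bar>(swap_op ^^ k) a (partner n)\<bar>"
    using abs_triangle_ineq[of "(1 + rate n) / 2 * (swap_op ^^ k) a n" "(1 - rate n) / 2 * (swap_op ^^ k) a (partner n)"]
    by (simp only: abs_mult abs_of_nonneg[OF r(1)] abs_of_nonneg[OF r(2)]
        funpow.simps comp_apply swap_op_def[of "(swap_op ^^ k) a"])
  also have "\<dots> \<le> (1 + rate n) / 2 * c + (1 - rate n) / 2 * c"
    using r Suc by (intro add_mono mult_left_mono)
  also have "\<dots> = c" by (simp add: field_simps)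
  finally show ?case .
qed

text \<open>The half difference contributes a geometric sum. Its denominator
  \<open>1 - rate n\<close> is at least 1, so it is bounded by 2 whatever the ratio; this gives a
  rate independent of \<open>n\<close>.\<close>

lemma swap_op_mean:
  assumes "\<And>n. \<bar>a n\<bar> \<le> c" and N: "N > 0"
  shows "\<bar>(1 / real N) * (\<Sum>k<N. (swap_op ^^ k) a n) - (a n + a (partner n)) / 2\<bar> \<le> 2 * c / real N"
proof -
  let ?t = "(a n - a (partner n)) / 2"
  have r: "rate n \<noteq> 1" "\<bar>rate n\<bar> \<le> 1" "1 \<le> 1 - rate n" using rate_bounds[of n] by auto
  have "(\<Sum>k<N. (swap_op ^^ k) a n) = real N * ((a n + a (partner n)) / 2) + (\<Sum>k<N. rate n ^ k) * ?t"
    unfolding swap_op_funpow sum.distrib sum_distrib_right by simp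
  then have "(1 / real N) * (\<Sum>k<N. (swap_op ^^ k) a n) - (a n + a (partner n)) / 2
      = (1 / real N) * ((\<Sum>k<N. rate n ^ k) * ?t)"
    using N by (simp add: field_simps)
  moreover have "\<bar>(\<Sum>k<N. rate n ^ k) * ?t\<bar> \<le> 2 * c"
  proof -
    have "\<bar>\<Sum>k<N. rate n ^ k\<bar> = \<bar>rate n ^ N - 1\<bar> / (1 - rate n)"
      using r by (simp add: geometric_sum abs_divide)
    also have "\<dots> \<le> \<bar>rate n ^ N - 1\<bar> / 1" using r by (intro divide_left_mono) auto
    also have "\<dots> \<le> 2" using power_le_one[of "\<bar>rate n\<bar>" N] abs_triangle_ineq4[of "rate n ^ N" 1] r by (simp add: power_abs)
    finally have 1: "\<bar>\<Sum>k<N. rate n ^ k\<bar> \<le> 2" .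
    have 2: "\<bar>?t\<bar> \<le> c" using assms(1)[of n] assms(1)[of "partner n"] by (auto simp: abs_le_iff)
    show ?thesis unfolding abs_mult using 1 2 by (intro mult_mono) auto
  qed
  moreover have "\<bar>(1 / real N) * q\<bar> \<le> 2 * c / real N" if "\<bar>q\<bar> \<le> 2 * c" for q
    using that N by (simp add: abs_mult divide_right_mono)
  ultimately show ?thesis by (simp only:)
qed

lemma (in order_bounded_disjoint) exists_mean_ergodic_not_wap:
  assumes d: "0 < d" "\<And>n. d \<le> norm (u n)"
  obtains T :: "'a \<Rightarrow> 'a" where "bounded_linear T" "positive_operator T" "power_bounded T"
    "mean_ergodic T" "\<not> weakly_almost_periodic T"
proof -
  obtain \<phi> where \<phi>: "\<And>i. linear (\<phi> i)" "\<And>i y. 0 \<le> y \<Longrightarrow> 0 \<le> \<phi> i y"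
    "\<And>i. \<phi> i (u i) = 1" "\<And>i y. \<bar>\<phi> i y\<bar> \<le> (1 / d) * norm y"
    "\<And>i y. 0 \<le> y \<Longrightarrow> inf y (u i) = 0 \<Longrightarrow> \<phi> i y = 0"
    using biorthogonal_functionals[of d u, OF d(1) u_nonneg d(2)] by metis
  interpret C: sequence_copy linf J \<phi> "norm x" "1 / d"
    by (rule sequence_copy_linf) (use \<phi> in blast)+
  interpret O: sequence_operator linf J \<phi> "norm x" "1 / d" swap_op 1
  proof
    show "swap_op a \<in> linf" if "a \<in> linf" for a
    proof -
      obtain c where "\<forall>n. \<bar>a n\<bar> \<le> c" using \<open>a \<in> linf\<close> unfolding linf_def by blast
      then show ?thesis using swap_op_bound[of a c 1] unfolding linf_def by auto
    qed
    show "swap_op (\<lambda>i. a i + b i) = (\<lambda>i. swap_op a i + swap_op b i)" for a b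
      by (simp add: swap_op_def fun_eq_iff field_simps)
    show "swap_op (\<lambda>i. c * a i) = (\<lambda>i. c * swap_op a i)" for a c
      by (simp add: swap_op_def fun_eq_iff field_simps)
    show "0 \<le> swap_op a i" if "\<And>i. 0 \<le> a i" for a i
      using that rate_bounds[of i] by (simp add: swap_op_def)
    show "\<bar>(swap_op ^^ n) a i\<bar> \<le> 1 * c" if "\<And>i. \<bar>a i\<bar> \<le> c" for a c n i
      using swap_op_bound[of a c n i] that by simp
    show "\<exists>b\<in>linf. \<forall>e>0. \<forall>\<^sub>F N in sequentially.
      \<forall>i. \<bar>(1 / real N) * (\<Sum>n<N. (swap_op ^^ n) a i) - b i\<bar> \<le> e" if "a \<in> linf" for a
    proof -
      obtain c where c: "\<forall>n. \<bar>a n\<bar> \<le> c" using \<open>a \<in> linf\<close> unfolding linf_def by blast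
      have "\<bar>(a i + a (partner i)) / 2\<bar> \<le> c" for i
        using c[rule_format, of i] c[rule_format, of "partner i"] by (auto simp: abs_le_iff)
      then have mem: "(\<lambda>i. (a i + a (partner i)) / 2) \<in> linf" unfolding linf_def by blast
      have lim: "\<forall>\<^sub>F N in sequentially. \<forall>i. \<bar>(1 / real N) * (\<Sum>n<N. (swap_op ^^ n) a i)
          - (a i + a (partner i)) / 2\<bar> \<le> e" if "e > 0" for e
      proof -
        have "(\<lambda>N. 2 * c / real N) \<longlonglongrightarrow> 0" by (rule lim_const_over_n)
        then have "\<forall>\<^sub>F N in sequentially. 2 * c / real N < e" using that by (rule order_tendstoD)
        then show ?thesis using eventually_gt_at_top[of 0]
        proof eventually_elim
          case (elim N)
          then show ?case using swap_op_mean[of a c N] c by (meson less_imp_le order_trans)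
        qed
      qed
      show ?thesis by (rule bexI[OF _ mem]) (intro allI impI lim)
    qed
  qed
  have "\<not> weakly_almost_periodic O.T"
  proof
    assume wap: "weakly_almost_periodic O.T"
    \<comment> \<open>On every pair of coordinates this is an eigenvector for
      \<open>rate\<close>.\<close>
    define a :: "nat \<Rightarrow> real" where "a n = (if even n then 1 else - 1)" for n
    have aL: "a \<in> linf" by (auto simp: linf_def a_def intro!: exI[of _ 1])
    have pow: "(swap_op ^^ k) a n = rate n ^ k * a n" for k n
      by (simp add: swap_op_funpow a_def partner_def)
    obtain y where y: "\<And>f l. bounded_linear f \<Longrightarrow>
        (\<lambda>j. f (J ((swap_op ^^ (2 * j)) a))) \<longlonglongrightarrow> (l::real) \<Longrightarrow> f y = l"
      using O.weak_cluster_point_of_powers[OF wap aL, of "\<lambda>j. 2 * j"] by blast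
    have phi_pow: "\<phi> n (J ((swap_op ^^ k) a)) = rate n ^ k * a n" for n k
      using C.phi_J[OF O.An_L[OF aL]] pow by simp
    have "\<phi> n y = 0" for n
    proof (rule y[OF C.bounded_linear_phi])
      have "\<bar>rate n\<bar> < 1" using rate_bounds[of n] by auto
      then have "(\<lambda>j. (rate n ^ 2) ^ j * a n) \<longlonglongrightarrow> 0 * a n"
        by (intro tendsto_mult tendsto_const LIMSEQ_power_zero) (simp add: abs_square_less_1)
      then show "(\<lambda>j. \<phi> n (J ((swap_op ^^ (2 * j)) a))) \<longlonglongrightarrow> 0"
        by (simp add: phi_pow power_mult)
    qed
    \<comment> \<open>A generalized limit over even coordinates: it is 0 at \<open>y\<close>, but 1
      at every even power, since \<open>rate\<close> tends to -1.\<close>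
    moreover obtain f where f: "bounded_linear f" "\<And>x l. (\<lambda>k. \<phi> (2 * k) x) \<longlonglongrightarrow> l \<Longrightarrow> f x = l"
      using banach_limit_functional[of "\<lambda>k. \<phi> (2 * k)", OF \<phi>(1) \<phi>(4)] by blast
    ultimately have "f y = 0" by simp
    moreover have "f y = 1"
    proof (rule y[OF f(1)])
      have "f (J ((swap_op ^^ (2 * j)) a)) = 1" for j
      proof (rule f(2))
        have "(\<lambda>k. (1 / real (k + 1) - 1) ^ (2 * j)) \<longlonglongrightarrow> (0 - 1) ^ (2 * j)"
          using LIMSEQ_inverse_real_of_nat
          by (intro tendsto_power tendsto_diff tendsto_const) (simp add: inverse_eq_divide)
        then show "(\<lambda>k. \<phi> (2 * k) (J ((swap_op ^^ (2 * j)) a))) \<longlonglongrightarrow> 1"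
          unfolding phi_pow by (simp add: a_def rate_def)
      qed
      then show "(\<lambda>j. f (J ((swap_op ^^ (2 * j)) a))) \<longlonglongrightarrow> 1" by simp
    qed
    ultimately show False by simp
  qed
  then show thesis
    using that O.bounded_linear_T O.positive_T O.power_bounded_T O.mean_ergodic_T by blast
qed

section \<open>Order continuous norms\<close>

text \<open>In a Banach lattice this convergence property is equivalent to order continuity of the
  norm, hence the name.\<close>

definition order_continuous_norm :: "'a::banach_lattice itself \<Rightarrow> bool" where
  "order_continuous_norm _ \<longleftrightarrow>
     (\<forall>(X::nat \<Rightarrow> 'a) b. (\<forall>n. 0 \<le> X n) \<and> incseq X \<and> (\<forall>n. X n \<le> b) \<longrightarrow> convergent X)"

text \<open>For the second infimum \<open>t\<close>, write \<open>t = t / k + (1 - 1 / k) t\<close>.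
  The first part is at most \<open>s / k\<close>, the second at most \<open>k z\<close> because
  \<open>(1 - 1 / k) (k + 1) \<le> k\<close>; this leaves room for \<open>inf y z \<le> z\<close>
  below \<open>(k + 1) z\<close>.\<close>

lemma inf_add_inf_scaleR_le:
  fixes s y z :: "'a::banach_lattice"
  assumes "0 \<le> s" "0 \<le> y" "0 \<le> z" "1 \<le> k"
  shows "inf y z + inf s ((k + 1) *\<^sub>R z) \<le> inf (s + y) ((k + 1) *\<^sub>R z) + (1 / k) *\<^sub>R s"
proof -
  let ?t = "inf s ((k + 1) *\<^sub>R z)"
  have "inf y z + ?t \<le> y + s" by (intro add_mono) auto
  also have "\<dots> \<le> (s + y) + (1 / k) *\<^sub>R s" using assms by (simp add: add.commute)
  finally have 1: "inf y z + ?t \<le> (s + y) + (1 / k) *\<^sub>R s" .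
  have "?t = (1 / k) *\<^sub>R ?t + (1 - 1 / k) *\<^sub>R ?t" by (simp flip: scaleR_add_left)
  also have "\<dots> \<le> (1 / k) *\<^sub>R s + (1 - 1 / k) *\<^sub>R ((k + 1) *\<^sub>R z)"
    using assms by (intro add_mono scaleR_left_mono) auto
  also have "(1 - 1 / k) *\<^sub>R ((k + 1) *\<^sub>R z) \<le> k *\<^sub>R z"
  proof -
    have "(1 - 1 / k) * (k + 1) \<le> k" using assms by (simp add: field_simps)
    then show ?thesis using assms by (simp add: scaleR_right_mono)
  qed
  finally have "?t \<le> (1 / k) *\<^sub>R s + k *\<^sub>R z" by simp
  then have "inf y z + ?t \<le> z + ((1 / k) *\<^sub>R s + k *\<^sub>R z)" by (intro add_mono) auto
  also have "\<dots> = (k + 1) *\<^sub>R z + (1 / k) *\<^sub>R s" by (simp add: scaleR_add_left algebra_simps)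
  finally show ?thesis using 1 by (simp add: add_inf_distrib_right)
qed

text \<open>The increment of \<open>inf (S n) ((k + 1) z)\<close> tends to 0 by order continuity; up to an error of order
  \<open>1 / k\<close> it dominates \<open>inf (y n) z\<close>.\<close>

lemma inf_tendsto_zero:
  fixes y :: "nat \<Rightarrow> 'a::banach_lattice"
  assumes oc: "order_continuous_norm TYPE('a)"
    and y: "\<And>n. 0 \<le> y n" "\<And>N. norm (\<Sum>n<N. y n) \<le> M" and z: "0 \<le> z"
  shows "(\<lambda>n. norm (inf (y n) z)) \<longlonglongrightarrow> 0"
proof (rule LIMSEQ_I)
  fix e :: real assume e: "0 < e"
  define S where "S N = (\<Sum>n<N. y n)" for N
  have S0: "0 \<le> S N" for N unfolding S_def by (intro sum_nonneg y)
  have M0: "0 \<le> M" using y(2)[of 0] by simp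
  \<comment> \<open>Makes \<open>M / k\<close> smaller than \<open>e / 2\<close>.\<close>
  define k where "k = 2 * M / e + 1"
  have k: "1 \<le> k" using e M0 by (simp add: k_def)
  have kM: "(1 / k) * M < e / 2" using e M0 by (simp add: k_def field_simps add_pos_nonneg)
  define W where "W n = inf (S n) ((k + 1) *\<^sub>R z)" for n
  have "convergent W"
  proof -
    have "incseq W" unfolding W_def S_def using y by (intro incseq_SucI inf_mono) auto
    moreover have "0 \<le> W n" "W n \<le> (k + 1) *\<^sub>R z" for n using S0 z k by (auto simp: W_def)
    ultimately show ?thesis using oc unfolding order_continuous_norm_def by blast
  qed
  then obtain l where l: "W \<longlonglongrightarrow> l" by (auto simp: convergent_def)
  have "(\<lambda>n. W (Suc n) - W n) \<longlonglongrightarrow> l - l" by (intro tendsto_diff l LIMSEQ_Suc)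
  then have "(\<lambda>n. W (Suc n) - W n) \<longlonglongrightarrow> 0" by simp
  then have "\<exists>n0. \<forall>n\<ge>n0. norm (W (Suc n) - W n - 0) < e / 2" using e by (intro LIMSEQ_D) auto
  then obtain n0 where n0: "\<And>n. n \<ge> n0 \<Longrightarrow> norm (W (Suc n) - W n) < e / 2" by auto
  show "\<exists>n0. \<forall>n\<ge>n0. norm (norm (inf (y n) z) - 0) < e"
  proof (intro exI allI impI)
    fix n assume n: "n0 \<le> n"
    have "inf (y n) z + W n \<le> W (Suc n) + (1 / k) *\<^sub>R S n"
      using inf_add_inf_scaleR_le[OF S0 y(1) z k, of n n] by (simp add: W_def S_def)
    then have "inf (y n) z \<le> (W (Suc n) - W n) + (1 / k) *\<^sub>R S n" by (simp add: algebra_simps)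
    then have "norm (inf (y n) z) \<le> norm ((W (Suc n) - W n) + (1 / k) *\<^sub>R S n)"
      using y z by (intro norm_mono_pos) auto
    also have "\<dots> \<le> norm (W (Suc n) - W n) + (1 / k) * norm (S n)"
      using norm_triangle_ineq[of "W (Suc n) - W n" "(1 / k) *\<^sub>R S n"] k by simp
    also have "\<dots> \<le> norm (W (Suc n) - W n) + (1 / k) * M"
      using y(2)[of n] k by (intro add_left_mono mult_left_mono) (auto simp: S_def)
    also have "\<dots> < e" using n0[OF n] kM by linarith
    finally show "norm (norm (inf (y n) z) - 0) < e" by simp
  qed
qed

section \<open>Disjointification of norm bounded blocks\<close>

lemma norm_bounded_blocks:
  fixes X :: "nat \<Rightarrow> 'a::banach_lattice"
  assumes X: "\<And>n. 0 \<le> X n" "incseq X" "bounded (range X)" "\<not> convergent X"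
  obtains y :: "nat \<Rightarrow> 'a" and \<delta> M where "0 < \<delta>" "\<And>n. 0 \<le> y n" "\<And>n. \<delta> \<le> norm (y n)"
    "\<And>N. norm (\<Sum>n<N. y n) \<le> M"
proof -
  obtain M where M: "\<And>n. norm (X n) \<le> M" using X(3) by (auto simp: bounded_iff)
  obtain d and p q :: "nat \<Rightarrow> nat" where d: "0 < d" and pq: "\<And>k. p k < q k" "\<And>j k. j < k \<Longrightarrow> q j \<le> p k"
    "\<And>k. d \<le> norm (X (p k) - X (q k))"
    using nonconvergent_blocks[OF X(4)] by metis
  have Xm: "X m \<le> X n" if "m \<le> n" for m n using X(2) that by (simp add: incseq_def)
  define y where "y k = X (q k) - X (p k)" for k
  have y0: "0 \<le> y k" for k using Xm[of "p k" "q k"] pq(1)[of k] by (simp add: y_def)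
  have le: "(\<Sum>k<N. y k) \<le> X (p N)" for N
  proof (induction N)
    case (Suc N)
    have "(\<Sum>k<Suc N. y k) \<le> X (p N) + y N" using Suc by simp
    also have "\<dots> \<le> X (p (Suc N))" using Xm[OF pq(2)[of N "Suc N"]] by (simp add: y_def)
    finally show ?case .
  qed (simp add: X)
  have "norm (\<Sum>k<N. y k) \<le> M" for N
    using norm_mono_pos[OF sum_nonneg le[of N]] y0 M[of "p N"] by force
  moreover have "d \<le> norm (y k)" for k using pq(3)[of k] by (simp add: y_def norm_minus_commute)
  ultimately show thesis using that d y0 by blast
qed

lemma pprt_le_iff: "0 \<le> b \<Longrightarrow> pprt a \<le> b \<longleftrightarrow> a \<le> (b::'a::lattice_ab_group_add)"
  by (auto simp: pprt_def)

text \<open>By \<open>inf_tendsto_zero\<close> a subsequence is almost disjoint from large multiples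
  of earlier partial sums, and small corrections make it exactly disjoint. The bound
  \<open>M\<close> survives because each new term lies below the selected \<open>y\<close>.\<close>

lemma norm_bounded_disjoint_sequence:
  fixes y :: "nat \<Rightarrow> 'a::banach_lattice"
  assumes oc: "order_continuous_norm TYPE('a)"
    and \<delta>: "0 < \<delta>" and y: "\<And>n. 0 \<le> y n" "\<And>n. \<delta> \<le> norm (y n)" "\<And>N. norm (\<Sum>n<N. y n) \<le> M"
  obtains u :: "nat \<Rightarrow> 'a" where "\<And>n. 0 \<le> u n" "\<And>n. \<delta> / 4 \<le> norm (u n)"
    "\<And>N. norm (\<Sum>n<N. u n) \<le> M" "\<And>m n. m \<noteq> n \<Longrightarrow> inf (u m) (u n) = 0"
proof -
  define S where "S N = (\<Sum>n<N. y n)" for N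
  have S0: "0 \<le> S N" for N unfolding S_def by (intro sum_nonneg y)
  have y_le_S: "y i \<le> S N" if "i < N" for i N
  proof -
    have "sum y {i} \<le> sum y {..<N}" using that y(1) by (intro sum_mono2) auto
    then show ?thesis by (simp add: S_def)
  qed
  \<comment> \<open>\<open>S (Suc (\<sigma> k))\<close> dominates every term selected so far, so one
    condition on the next term handles them all.\<close>
  have "\<exists>\<sigma>. \<forall>k. True \<and> (\<sigma> k < \<sigma> (Suc k) \<and>
      norm (inf (y (\<sigma> (Suc k))) (4 ^ Suc k *\<^sub>R S (Suc (\<sigma> k)))) < \<delta> / 4)"
  proof (rule dependent_nat_choice)
    fix m k :: nat
    have "(\<lambda>n. norm (inf (y n) (4 ^ Suc k *\<^sub>R S (Suc m)))) \<longlonglongrightarrow> 0"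
      using S0 by (intro inf_tendsto_zero[OF oc y(1,3)]) auto
    then have "\<forall>\<^sub>F n in sequentially. norm (inf (y n) (4 ^ Suc k *\<^sub>R S (Suc m))) < \<delta> / 4"
      using \<delta> by (intro order_tendstoD) auto
    then have "\<forall>\<^sub>F n in sequentially. m < n \<and> norm (inf (y n) (4 ^ Suc k *\<^sub>R S (Suc m))) < \<delta> / 4"
      using eventually_gt_at_top[of m] by eventually_elim auto
    then show "\<exists>n. True \<and> m < n \<and> norm (inf (y n) (4 ^ Suc k *\<^sub>R S (Suc m))) < \<delta> / 4"
      by (auto simp: eventually_sequentially)
  qed simp
  then obtain \<sigma> where \<sigma>: "\<And>k. \<sigma> k < \<sigma> (Suc k)"
    "\<And>k. norm (inf (y (\<sigma> (Suc k))) (4 ^ Suc k *\<^sub>R S (Suc (\<sigma> k)))) < \<delta> / 4" by blast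
  have smono: "strict_mono \<sigma>" using \<sigma>(1) by (simp add: strict_mono_Suc_iff)
  define a where "a k = y (\<sigma> k)" for k
  have a0: "0 \<le> a k" for k by (simp add: a_def y)
  have norm_a: "norm (a k) \<le> M" for k
  proof -
    have "norm (a k) \<le> norm (S (Suc (\<sigma> k)))" by (intro norm_mono_pos a0) (simp add: a_def y_le_S)
    then show ?thesis using y(3)[of "Suc (\<sigma> k)"] by (simp add: S_def)
  qed
  \<comment> \<open>The weights force convergence, yet \<open>w\<close> still dominates a fixed
    positive multiple of every selected term, including all later ones.\<close>
  define w where "w = (\<Sum>i. (1 / 2) ^ i *\<^sub>R a i)"
  have summ: "summable (\<lambda>i. (1 / 2) ^ i *\<^sub>R a i)"
  proof (rule summable_comparison_test)
    show "summable (\<lambda>i. (1 / 2 :: real) ^ i * M)" by (intro summable_mult2 summable_geometric) simp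
    show "\<exists>N. \<forall>n\<ge>N. norm ((1 / 2) ^ n *\<^sub>R a n) \<le> (1 / 2) ^ n * M"
      using norm_a by (auto intro!: mult_left_mono)
  qed
  have a_le_w: "(1 / 2) ^ i *\<^sub>R a i \<le> w" for i
  proof -
    have "(\<lambda>N. (\<Sum>j<N. (1 / 2) ^ j *\<^sub>R a j) - (1 / 2) ^ i *\<^sub>R a i) \<longlonglongrightarrow> w - (1 / 2) ^ i *\<^sub>R a i"
      unfolding w_def by (intro tendsto_diff summable_LIMSEQ summ tendsto_const)
    then have "0 \<le> w - (1 / 2) ^ i *\<^sub>R a i"
    proof (rule tendsto_nonneg_lattice)
      have "0 \<le> (\<Sum>j<N. (1 / 2) ^ j *\<^sub>R a j) - (1 / 2) ^ i *\<^sub>R a i" if "Suc i \<le> N" for N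
      proof -
        have "(\<Sum>j\<in>{i}. (1 / 2) ^ j *\<^sub>R a j) \<le> (\<Sum>j<N. (1 / 2) ^ j *\<^sub>R a j)"
          using that a0 by (intro sum_mono2) auto
        then show ?thesis by simp
      qed
      then show "\<forall>\<^sub>F N in sequentially. 0 \<le> (\<Sum>j<N. (1 / 2) ^ j *\<^sub>R a j) - (1 / 2) ^ i *\<^sub>R a i"
        by (auto simp: eventually_sequentially intro!: exI[of _ "Suc i"])
    qed
    then show ?thesis by simp
  qed
  have w0: "0 \<le> w" using a_le_w[of 0] a0[of 0] by simp
  define b where "b k = (case k of 0 \<Rightarrow> 0 | Suc j \<Rightarrow> 4 ^ Suc j *\<^sub>R S (Suc (\<sigma> j)))" for k
  have b0: "0 \<le> b k" for k using S0 by (simp add: b_def split: nat.split)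
  have inf_ab: "norm (inf (a k) (b k)) \<le> \<delta> / 4" for k
    using \<sigma>(2) a0 \<delta> by (cases k) (auto simp: a_def b_def inf_absorb2 less_imp_le)
  have a_le_b: "4 ^ k *\<^sub>R a m \<le> b k" if mk: "m < k" for m k
  proof (cases k)
    case (Suc j)
    then have "\<sigma> m \<le> \<sigma> j" using mk smono by (simp add: strict_mono_less_eq)
    then have "a m \<le> S (Suc (\<sigma> j))" unfolding a_def by (intro y_le_S) simp
    then show ?thesis using Suc by (simp add: b_def scaleR_left_mono)
  qed (use mk in simp)
  txt \<open>Subtracting \<open>b k\<close> makes \<open>v k\<close> disjoint from earlier terms, and subtracting a multiple of \<open>w\<close>
    from later ones; both corrections are small in norm.\<close>
  define v where "v k = pprt (a k - b k - (1 / 2) ^ k *\<^sub>R w)" for k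
  have v0: "0 \<le> v k" for k by (simp add: v_def)
  have v_le: "v k \<le> a k" for k
  proof -
    have "0 \<le> b k + (1 / 2) ^ k *\<^sub>R w" using b0 w0 by (intro add_nonneg_nonneg) auto
    then have "a k \<le> a k + (b k + (1 / 2) ^ k *\<^sub>R w)" by (rule add_increasing2) simp
    then show ?thesis using a0 by (simp add: v_def pprt_le_iff diff_diff_eq diff_le_eq)
  qed
  \<comment> \<open>\<open>v m\<close> lies below a multiple of the positive part of
    \<open>?c\<close>, and \<open>v k\<close> below its negative part.\<close>
  have v_disj: "inf (v m) (v k) = 0" if mk: "m < k" for m k
  proof (rule inf_le_disjoint[OF v0 _ v0])
    let ?c = "4 ^ k *\<^sub>R a m - a k"
    have "a k - b k - (1 / 2) ^ k *\<^sub>R w \<le> - ?c"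
      using a_le_b[OF mk] w0 by (simp add: algebra_simps add_increasing2)
    then show "v k \<le> pprt (- ?c)" unfolding v_def by (rule pprt_mono)
    have "(1 / 2) ^ (m + k) *\<^sub>R a k \<le> (1 / 2) ^ m *\<^sub>R w"
      using scaleR_left_mono[OF a_le_w[of k], of "(1 / 2) ^ m"] by (simp add: power_add)
    \<comment> \<open>Here \<open>4 ^ k\<close> outweighs \<open>(1 / 2) ^ (m + k)\<close> because
      \<open>m < k\<close>.\<close>
    moreover have "a m \<le> ((1 / 2) ^ (m + k) * 4 ^ k) *\<^sub>R a m"
    proof -
      have "(2::real) ^ (m + k) \<le> 2 ^ (2 * k)" using mk by (intro power_increasing) auto
      then have "1 \<le> (1 / 2) ^ (m + k) * (4::real) ^ k" by (simp add: power_mult power_divide)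
      then show ?thesis using scaleR_right_mono[of 1 "(1 / 2) ^ (m + k) * 4 ^ k" "a m"] a0 by simp
    qed
    ultimately have "a m - (1 / 2) ^ m *\<^sub>R w \<le> (1 / 2) ^ (m + k) *\<^sub>R ?c"
      unfolding scaleR_diff_right scaleR_scaleR by (rule diff_mono[rotated])
    moreover have "a m - b m - (1 / 2) ^ m *\<^sub>R w \<le> a m - (1 / 2) ^ m *\<^sub>R w" using b0 by simp
    ultimately have "v m \<le> pprt ((1 / 2) ^ (m + k) *\<^sub>R ?c)"
      unfolding v_def by (intro pprt_mono) (rule order_trans)
    then show "v m \<le> (1 / 2) ^ (m + k) *\<^sub>R pprt ?c" by (simp add: pprt_scaleR)
    show "inf ((1 / 2) ^ (m + k) *\<^sub>R pprt ?c) (pprt (- ?c)) = 0"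
      using inf_scaleR_disjoint[of "pprt ?c" "pprt (- ?c)" "(1 / 2) ^ (m + k)" 1] inf_pprt_disjoint[of ?c]
      by simp
  qed
  have "(\<lambda>k. (1 / 2) ^ k * norm w) \<longlonglongrightarrow> 0"
    by (intro tendsto_mult_left_zero LIMSEQ_realpow_zero) auto
  then have "\<forall>\<^sub>F k in sequentially. (1 / 2) ^ k * norm w < \<delta> / 4"
    using \<delta> by (intro order_tendstoD) auto
  then obtain K where K: "\<And>k. K \<le> k \<Longrightarrow> (1 / 2) ^ k * norm w < \<delta> / 4"
    by (auto simp: eventually_sequentially)
  \<comment> \<open>The overlap with \<open>b k\<close> and the correction by \<open>w\<close> each
    cost at most a quarter of \<open>\<delta>\<close>, the latter only from \<open>K\<close> on;
    hence the final shift by \<open>K\<close>.\<close>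
  have norm_v: "\<delta> / 4 \<le> norm (v k)" if "K \<le> k" for k
  proof -
    have "pprt (a k - b k) \<le> v k + (1 / 2) ^ k *\<^sub>R w"
      using pprt_add_le[of "a k - b k - (1 / 2) ^ k *\<^sub>R w" "(1 / 2) ^ k *\<^sub>R w"] w0 by (simp add: v_def)
    then have "a k \<le> (v k + (1 / 2) ^ k *\<^sub>R w) + inf (a k) (b k)"
      unfolding pprt_diff_inf by (simp only: diff_le_eq)
    then have "norm (a k) \<le> norm ((v k + (1 / 2) ^ k *\<^sub>R w) + inf (a k) (b k))"
      by (intro norm_mono_pos a0)
    also have "\<dots> \<le> norm (v k) + (1 / 2) ^ k * norm w + norm (inf (a k) (b k))"
      using norm_triangle_ineq[of "v k + (1 / 2) ^ k *\<^sub>R w" "inf (a k) (b k)"]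
        norm_triangle_ineq[of "v k" "(1 / 2) ^ k *\<^sub>R w"] by simp
    finally show ?thesis using K[OF that] inf_ab[of k] y(2)[of "\<sigma> k"] \<delta> unfolding a_def by linarith
  qed
  show thesis
  proof (rule that[of "\<lambda>n. v (n + K)"])
    show "norm (\<Sum>n<N. v (n + K)) \<le> M" for N
    proof -
      have inj: "inj_on (\<lambda>n. \<sigma> (n + K)) {..<N}"
        using smono by (auto simp: inj_on_def strict_mono_eq)
      have "(\<Sum>n<N. v (n + K)) \<le> (\<Sum>n<N. y (\<sigma> (n + K)))"
        by (intro sum_mono) (use v_le in \<open>simp add: a_def\<close>)
      also have "\<dots> = sum y ((\<lambda>n. \<sigma> (n + K)) ` {..<N})" using inj by (simp add: sum.reindex)
      also have "\<dots> \<le> S (Suc (\<sigma> (N + K)))"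
        unfolding S_def using y(1) smono
        by (intro sum_mono2) (auto simp: strict_mono_less_eq less_Suc_eq_le)
      finally have "norm (\<Sum>n<N. v (n + K)) \<le> norm (S (Suc (\<sigma> (N + K))))"
        using v0 by (intro norm_mono_pos sum_nonneg)
      then show ?thesis using y(3)[of "Suc (\<sigma> (N + K))"] by (simp add: S_def)
    qed
    show "inf (v (m + K)) (v (n + K)) = 0" if "m \<noteq> n" for m n
      using v_disj[of "m + K" "n + K"] v_disj[of "n + K" "m + K"] that
      by (cases "m < n") (auto simp: inf_commute)
  qed (use v0 norm_v in auto)
qed

text \<open>Disjointness keeps the partial sums below \<open>x\<close>, so they converge and their
  increments \<open>w n\<close> tend to 0.\<close>

lemma disjoint_tendsto_zero:
  fixes w :: "nat \<Rightarrow> 'a::banach_lattice"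
  assumes oc: "order_continuous_norm TYPE('a)"
    and w: "\<And>n. 0 \<le> w n" "\<And>n. w n \<le> x" "\<And>m n. m \<noteq> n \<Longrightarrow> inf (w m) (w n) = 0"
  shows "w \<longlonglongrightarrow> 0"
proof -
  define S where "S N = (\<Sum>n<N. w n)" for N
  have "0 \<le> x" using w(1)[of 0] w(2)[of 0] by simp
  then have "S N \<le> x" for N unfolding S_def using w by (intro sum_disjoint_le) auto
  moreover have "incseq S" unfolding S_def using w by (intro incseq_SucI) simp
  moreover have "0 \<le> S N" for N unfolding S_def using w by (intro sum_nonneg)
  ultimately have "convergent S" using oc unfolding order_continuous_norm_def by blast
  then obtain l where l: "S \<longlonglongrightarrow> l" by (auto simp: convergent_def)
  have "(\<lambda>n. S (Suc n) - S n) \<longlonglongrightarrow> l - l" by (intro tendsto_diff l LIMSEQ_Suc)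
  then show ?thesis by (simp add: S_def)
qed

section \<open>A positively complemented copy of the null sequences\<close>

locale norm_bounded_disjoint =
  fixes u :: "nat \<Rightarrow> 'a::banach_lattice" and d M :: real
  assumes oc: "order_continuous_norm TYPE('a)"
    and d_pos: "0 < d" and u_nonneg: "0 \<le> u n" and u_norm: "d \<le> norm (u n)"
    and u_sum: "norm (\<Sum>n<N. u n) \<le> M"
    and u_disjoint: "m \<noteq> n \<Longrightarrow> inf (u m) (u n) = 0"
begin

definition c0 :: "(nat \<Rightarrow> real) set" where
  "c0 = {a. a \<longlonglongrightarrow> 0}"

definition J :: "(nat \<Rightarrow> real) \<Rightarrow> 'a" where
  "J a = (\<Sum>n. a n *\<^sub>R u n)"

lemma norm_block_le:
  assumes "\<And>n. m \<le> n \<Longrightarrow> \<bar>a n\<bar> \<le> c"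
  shows "norm (\<Sum>n=m..<k. a n *\<^sub>R u n) \<le> c * M"
proof -
  have c: "0 \<le> c" using assms[of m] by linarith
  have "\<bar>\<Sum>n=m..<k. a n *\<^sub>R u n\<bar> \<le> (\<Sum>n=m..<k. \<bar>a n *\<^sub>R u n\<bar>)" by (rule sum_abs)
  also have "\<dots> \<le> (\<Sum>n=m..<k. c *\<^sub>R u n)"
  proof (rule sum_mono)
    fix n assume "n \<in> {m..<k}"
    then have "a n \<le> c" "- a n \<le> c" using assms[of n] by (auto simp: abs_le_iff)
    then have "a n *\<^sub>R u n \<le> c *\<^sub>R u n" "(- a n) *\<^sub>R u n \<le> c *\<^sub>R u n"
      using u_nonneg by (blast intro: scaleR_right_mono)+
    then show "\<bar>a n *\<^sub>R u n\<bar> \<le> c *\<^sub>R u n" by (intro abs_leI) simp_all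
  qed
  also have "\<dots> \<le> (\<Sum>n<k. c *\<^sub>R u n)"
    using u_nonneg c by (intro sum_mono2) auto
  also have "\<dots> = c *\<^sub>R (\<Sum>n<k. u n)" by (simp add: scaleR_sum_right)
  finally have "norm (\<Sum>n=m..<k. a n *\<^sub>R u n) \<le> norm (c *\<^sub>R (\<Sum>n<k. u n))"
    using u_nonneg c by (intro norm_mono_abs) (auto simp: sum_nonneg)
  also have "\<dots> \<le> c * M" using u_sum[of k] c by (simp add: mult_left_mono)
  finally show ?thesis .
qed

lemma M_nonneg: "0 \<le> M"
  using u_sum[of 0] by simp

lemma J_summable:
  assumes "a \<in> c0"
  shows "summable (\<lambda>n. a n *\<^sub>R u n)"
  unfolding summable_Cauchy
proof (intro allI impI)
  fix e :: real assume e: "0 < e"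
  then have e': "0 < e / (M + 1)" using M_nonneg by simp
  then obtain m0 where m0: "\<And>n. m0 \<le> n \<Longrightarrow> \<bar>a n\<bar> < e / (M + 1)"
    using assms unfolding c0_def by (force dest: LIMSEQ_D)
  show "\<exists>N. \<forall>m\<ge>N. \<forall>n. norm (\<Sum>n=m..<n. a n *\<^sub>R u n) < e"
  proof (intro exI allI impI)
    fix m n assume m: "m0 \<le> m"
    have "norm (\<Sum>n=m..<n. a n *\<^sub>R u n) \<le> e / (M + 1) * M"
      using m0 m by (intro norm_block_le) (meson less_imp_le order_trans)
    also have "\<dots> < e" using e M_nonneg by (simp add: field_simps)
    finally show "norm (\<Sum>n=m..<n. a n *\<^sub>R u n) < e" .
  qed
qed

lemma J_sums:
  assumes "a \<in> c0"
  shows "(\<lambda>N. \<Sum>n<N. a n *\<^sub>R u n) \<longlonglongrightarrow> J a"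
  unfolding J_def by (rule summable_LIMSEQ[OF J_summable[OF assms]])

text \<open>For positive \<open>y\<close>, the infima of \<open>y\<close> with multiples of
  \<open>u i\<close> are disjoint and order bounded, so their norms tend to 0. They control
  \<open>\<phi> i y\<close> up to an error that is chosen to vanish in the limit.\<close>

lemma phi_null:
  assumes lin: "\<And>i. linear (\<phi> i)" and pos: "\<And>i y. 0 \<le> y \<Longrightarrow> (0::real) \<le> \<phi> i y"
    and approx: "\<And>i y e. 0 \<le> y \<Longrightarrow> 0 < e \<Longrightarrow> \<exists>k\<ge>0. d * \<phi> i y \<le> norm (inf y (k *\<^sub>R u i)) + e"
  shows "(\<lambda>i. \<phi> i x) \<longlonglongrightarrow> 0"
proof -
  have *: "(\<lambda>i. \<phi> i y) \<longlonglongrightarrow> 0" if y: "0 \<le> y" for y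
  proof -
    have "\<exists>k\<ge>0. d * \<phi> i y \<le> norm (inf y (k *\<^sub>R u i)) + inverse (real (Suc i))" for i
      using y by (intro approx) auto
    then obtain k where k: "\<And>i. 0 \<le> k i"
      "\<And>i. d * \<phi> i y \<le> norm (inf y (k i *\<^sub>R u i)) + inverse (real (Suc i))" by metis
    define w where "w i = inf y (k i *\<^sub>R u i)" for i
    have "w \<longlonglongrightarrow> 0"
    proof (rule disjoint_tendsto_zero[OF oc])
      show "0 \<le> w n" "w n \<le> y" for n using y k(1) u_nonneg by (auto simp: w_def)
      show "inf (w m) (w n) = 0" if "m \<noteq> n" for m n
        unfolding w_def
        by (rule inf_le_disjoint[OF _ inf_le2 _ inf_le2 inf_scaleR_disjoint[OF u_nonneg u_nonneg u_disjoint[OF that] k(1) k(1)]])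
          (use y k(1) u_nonneg in auto)
    qed
    then have "(\<lambda>i. (norm (w i) + inverse (real (Suc i))) / d) \<longlonglongrightarrow> (0 + 0) / d"
      using d_pos by (intro tendsto_divide tendsto_add tendsto_norm_zero LIMSEQ_inverse_real_of_nat) auto
    then have lim: "(\<lambda>i. (norm (w i) + inverse (real (Suc i))) / d) \<longlonglongrightarrow> 0" by simp
    show ?thesis
    proof (rule tendsto_sandwich[OF _ _ tendsto_const lim])
      show "\<forall>\<^sub>F i in sequentially. 0 \<le> \<phi> i y" using pos[OF y] by simp
      have "\<phi> i y \<le> (norm (w i) + inverse (real (Suc i))) / d" for i
        using k(2)[of i] d_pos unfolding w_def by (simp add: pos_le_divide_eq mult.commute)
      then show "\<forall>\<^sub>F i in sequentially. \<phi> i y \<le> (norm (w i) + inverse (real (Suc i))) / d" by simp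
    qed
  qed
  have "(\<lambda>i. \<phi> i (pprt x) - \<phi> i (pprt (- x))) \<longlonglongrightarrow> 0 - 0" by (intro tendsto_diff *) auto
  moreover have "\<phi> i (pprt x) - \<phi> i (pprt (- x)) = \<phi> i x" for i
  proof -
    have "pprt x - pprt (- x) = x" using prts[of x] by (simp add: pprt_neg)
    then show ?thesis using linear_diff[OF lin] by metis
  qed
  ultimately show ?thesis by simp
qed

lemma sequence_copy_c0:
  assumes lin: "\<And>i. linear (\<phi> i)" and pos: "\<And>i y. 0 \<le> y \<Longrightarrow> (0::real) \<le> \<phi> i y"
    and one: "\<And>i. \<phi> i (u i) = 1" and bound: "\<And>i y. \<bar>\<phi> i y\<bar> \<le> D * norm y"
    and disj: "\<And>i y. 0 \<le> y \<Longrightarrow> inf y (u i) = 0 \<Longrightarrow> \<phi> i y = 0"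
    and approx: "\<And>i y e. 0 \<le> y \<Longrightarrow> 0 < e \<Longrightarrow> \<exists>k\<ge>0. d * \<phi> i y \<le> norm (inf y (k *\<^sub>R u i)) + e"
  shows "sequence_copy c0 J \<phi> M D"
proof (rule sequence_copy.intro)
  show "(\<lambda>i. a i + b i) \<in> c0" if "a \<in> c0" "b \<in> c0" for a b
    using that tendsto_add[of a 0 _ b 0] by (simp add: c0_def)
  show "(\<lambda>i. c * a i) \<in> c0" if "a \<in> c0" for a c
    using that tendsto_mult_left[of a 0 _ c] by (simp add: c0_def)
  show "J (\<lambda>i. a i + b i) = J a + J b" if "a \<in> c0" "b \<in> c0" for a b
    unfolding J_def using suminf_add[OF J_summable J_summable] that by (simp add: scaleR_add_left)
  show "J (\<lambda>i. c * a i) = c *\<^sub>R J a" if "a \<in> c0" for a c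
    unfolding J_def using suminf_scaleR_right[OF J_summable[OF that], of c] by simp
  show "0 \<le> J a" if "a \<in> c0" "\<And>i. 0 \<le> a i" for a
    by (rule tendsto_nonneg_lattice[OF J_sums[OF that(1)]]) (simp add: that u_nonneg sum_nonneg)
  show "norm (J a) \<le> M * c" if "a \<in> c0" "\<And>i. \<bar>a i\<bar> \<le> c" for a c
  proof (rule tendsto_upperbound[OF tendsto_norm[OF J_sums[OF that(1)]]])
    have "norm (\<Sum>n<N. a n *\<^sub>R u n) \<le> M * c" for N
      using norm_block_le[of 0 a c N] that(2) by (simp add: atLeast0LessThan mult.commute)
    then show "\<forall>\<^sub>F N in sequentially. norm (\<Sum>n<N. a n *\<^sub>R u n) \<le> M * c" by simp
  qed simp
  show "(\<lambda>i. \<phi> i x) \<in> c0" for x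
    unfolding c0_def using phi_null[OF lin pos approx] by blast
  show "\<phi> i (J a) = a i" if "a \<in> c0" for a i
  proof (rule LIMSEQ_unique)
    have bl: "bounded_linear (\<phi> i)"
      by (rule bounded_linear_if_dominated[OF lin, of _ D]) (use bound in \<open>simp add: abs_le_iff\<close>)
    show "(\<lambda>N. \<phi> i (\<Sum>n<N. a n *\<^sub>R u n)) \<longlonglongrightarrow> \<phi> i (J a)"
      by (rule bounded_linear.tendsto[OF bl J_sums[OF that]])
    have phi_u: "\<phi> i (u n) = (if n = i then 1 else 0)" for n
      using one disj[OF u_nonneg u_disjoint] by auto
    have "\<phi> i (\<Sum>n<N. a n *\<^sub>R u n) = (\<Sum>n<N. if n = i then a n else 0)" for N
      unfolding linear_sum[OF lin] linear_scale[OF lin] phi_u by (intro sum.cong) auto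
    then have "\<phi> i (\<Sum>n<N. a n *\<^sub>R u n) = (if i < N then a i else 0)" for N
      by (simp add: sum.delta)
    then have "\<forall>\<^sub>F N in sequentially. \<phi> i (\<Sum>n<N. a n *\<^sub>R u n) = a i"
      by (auto simp: eventually_sequentially intro!: exI[of _ "Suc i"])
    then show "(\<lambda>N. \<phi> i (\<Sum>n<N. a n *\<^sub>R u n)) \<longlonglongrightarrow> a i" by (rule tendsto_eventually)
  qed
qed (fact lin pos bound)+

end

text \<open>The disjoint sequence is indexed by naturals, whereas the walk lives on pairs.\<close>

lemma sequence_copy_reindex:
  assumes "sequence_copy L J \<phi> C D" and g: "\<And>i. h (g i) = i" "\<And>n. g (h n) = n"
  shows "sequence_copy {a. (\<lambda>n. a (h n)) \<in> L} (\<lambda>a. J (\<lambda>n. a (h n))) (\<lambda>i. \<phi> (g i)) C D"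
proof -
  interpret sequence_copy L J \<phi> C D by fact
  show ?thesis
    by (rule sequence_copy.intro)
      (simp_all add: L_add L_scale J_add J_scale J_pos J_bound phi_linear phi_pos phi_bound phi_L phi_J g)
qed

section \<open>The operator on a copy of null sequences\<close>

definition powers_of_3 :: "nat set" where
  "powers_of_3 = range (\<lambda>k. 3 ^ k)"

text \<open>The value at \<open>q\<close> sums \<open>a\<close> over the positions occupied one step
  after a start at \<open>q\<close>; powers sum over later times. The cutoff
  \<open>i \<le> r\<close> lets each \<open>(0, r)\<close> receive particles from only finitely many
  columns, which keeps null families null.\<close>

definition walk_op :: "(nat \<times> nat \<Rightarrow> real) \<Rightarrow> nat \<times> nat \<Rightarrow> real" where
  "walk_op a q = (case q of
     (0, 0) \<Rightarrow> 0
   | (0, Suc m) \<Rightarrow> a (0, m)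
   | (Suc i, r) \<Rightarrow> a (Suc i, Suc r) + (if r \<in> powers_of_3 \<and> i \<le> r then a (0, r) else 0))"

lemma walk_op_simps:
  "walk_op a (0, m) = (case m of 0 \<Rightarrow> 0 | Suc m' \<Rightarrow> a (0, m'))"
  "walk_op a (Suc i, r) = a (Suc i, Suc r) + (if r \<in> powers_of_3 \<and> i \<le> r then a (0, r) else 0)"
  by (auto simp: walk_op_def split: nat.split)

text \<open>The emission sites, for a walker started at \<open>(Suc i, r)\<close>, of the particles alive at time \<open>n\<close>.\<close>

definition emissions :: "nat \<Rightarrow> nat \<Rightarrow> nat \<Rightarrow> nat set" where
  "emissions i r n = {s \<in> {r..<r + n}. s \<in> powers_of_3 \<and> i \<le> s \<and> r + n \<le> 2 * s + 1}"

lemma finite_emissions [simp]: "finite (emissions i r n)"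
  by (simp add: emissions_def)

lemma walk_op_funpow_0: "(walk_op ^^ n) a (0, m) = (if n \<le> m then a (0, m - n) else 0)"
  by (induction n arbitrary: m) (auto simp: walk_op_simps split: nat.split)

text \<open>The walker is at \<open>s\<close> at time \<open>s - r\<close>. The particle emitted
  there is at height \<open>s\<close> one step later and then descends, so its height at time
  \<open>n\<close> is \<open>2 * s + 1 - (r + n)\<close>.\<close>

lemma walk_op_funpow_Suc:
  "(walk_op ^^ n) a (Suc i, r) = a (Suc i, r + n) + (\<Sum>s\<in>emissions i r n. a (0, 2 * s + 1 - (r + n)))"
proof (induction n arbitrary: r)
  case 0
  then show ?case by (simp add: emissions_def)
next
  case (Suc n)
  let ?P = "r \<in> powers_of_3 \<and> i \<le> r"
  let ?g = "\<lambda>s. a (0, 2 * s + 1 - (r + Suc n))"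
  \<comment> \<open>After one step the walker starts from \<open>Suc r\<close> with \<open>n\<close>
    steps left; the only emission not seen from there is the one at \<open>r\<close>.\<close>
  have split: "emissions i r (Suc n) = emissions i (Suc r) n \<union> (if ?P \<and> n \<le> r then {r} else {})"
  proof (rule set_eqI)
    show "s \<in> emissions i r (Suc n)
        \<longleftrightarrow> s \<in> emissions i (Suc r) n \<union> (if ?P \<and> n \<le> r then {r} else {})" for s
      by (cases "s = r") (auto simp: emissions_def)
  qed
  have "r \<notin> emissions i (Suc r) n" by (simp add: emissions_def)
  then have sum: "(\<Sum>s\<in>emissions i r (Suc n). ?g s)
      = (\<Sum>s\<in>emissions i (Suc r) n. ?g s) + (if ?P \<and> n \<le> r then a (0, r - n) else 0)"
    unfolding split by simp
  have "(walk_op ^^ Suc n) a (Suc i, r) = (walk_op ^^ n) a (Suc i, Suc r)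
      + (if ?P then (walk_op ^^ n) a (0, r) else 0)"
    by (simp add: walk_op_simps)
  also have "\<dots> = a (Suc i, r + Suc n) + (\<Sum>s\<in>emissions i (Suc r) n. ?g s)
      + (if ?P \<and> n \<le> r then a (0, r - n) else 0)"
    by (simp add: Suc.IH walk_op_funpow_0)
  finally show ?case unfolding sum by simp
qed

text \<open>This is why the sites are powers of three: a particle from \<open>s\<close> lives while
  \<open>r + n \<le> 2 * s + 1\<close>, but a later emission requires
  \<open>r + n > 3 * s\<close>.\<close>

lemma emissions_unique:
  assumes "s \<in> emissions i r n" "s' \<in> emissions i r n"
  shows "s = s'"
proof -
  have *: False if st: "s \<in> emissions i r n" "s' \<in> emissions i r n" "s < s'" for s s'
  proof -
    obtain j k where jk: "s = 3 ^ j" "s' = 3 ^ k" using st by (auto simp: emissions_def powers_of_3_def)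
    have "Suc j \<le> k" using st(3) jk by simp
    then have "(3::nat) ^ Suc j \<le> 3 ^ k" by (intro power_increasing) auto
    then have "3 * s \<le> s'" using jk by simp
    moreover have "s' < r + n" "r + n \<le> 2 * s + 1" using st by (auto simp: emissions_def)
    moreover have "0 < s" using jk by simp
    ultimately show False by linarith
  qed
  show ?thesis using *[of s s'] *[of s' s] assms by (cases s s' rule: linorder_cases) auto
qed

lemma emissions_cases:
  obtains "emissions i r n = {}" | s where "emissions i r n = {s}"
  using emissions_unique[of _ i r n] by blast

text \<open>At most two positions are occupied at any time: one by the walker and one by a
  particle.\<close>

lemma walk_op_bound:
  assumes "\<And>q. \<bar>a q\<bar> \<le> c"
  shows "\<bar>(walk_op ^^ n) a q\<bar> \<le> 2 * c"
proof -
  obtain i r where q: "q = (i, r)" by (cases q)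
  have c: "0 \<le> c" using assms[of q] by linarith
  show ?thesis
  proof (cases i)
    case 0
    then show ?thesis using assms[of "(0, r - n)"] c q by (auto simp: walk_op_funpow_0)
  next
    case (Suc j)
    show ?thesis
    proof (cases rule: emissions_cases[of j r n])
      case 1
      then show ?thesis using assms[of "(Suc j, r + n)"] c q Suc by (simp add: walk_op_funpow_Suc)
    next
      case (2 s)
      then show ?thesis
        using assms[of "(Suc j, r + n)"] assms[of "(0, 2 * s + 1 - (r + n))"] q Suc
        by (simp add: walk_op_funpow_Suc)
    qed
  qed
qed

section \<open>Sparsity of the arrival times\<close>

lemma square_less_power_3: "j ^ 2 + 1 \<le> (3::nat) ^ j"
proof (induction j)
  case (Suc j)
  have "(Suc j) ^ 2 + 1 \<le> 3 * (j ^ 2 + 1)"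
    using power2_eq_square[of j] by (cases j; cases "j - 1") (auto simp: power2_eq_square)
  also have "\<dots> \<le> 3 * 3 ^ j" using Suc by (rule mult_le_mono2)
  finally show ?case by simp
qed simp

text \<open>Exponents occurring in a window of length \<open>N\<close> differ from the smallest one
  by at most \<open>sqrt N\<close>, by quadratic growth of \<open>3 ^ j\<close>. What matters is
  that the bound is of lower order than \<open>N\<close> and independent of the offset
  \<open>t\<close>.\<close>

lemma card_arrival_times:
  "finite {n. n < N \<and> (\<exists>k. t + n = 2 * 3 ^ k + 1)}"
  "real (card {n. n < N \<and> (\<exists>k. t + n = 2 * 3 ^ k + (1::nat))}) \<le> sqrt (real N) + 1"
proof -
  let ?B = "{n. n < N \<and> (\<exists>k. t + n = 2 * 3 ^ k + (1::nat))}"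
  show fin: "finite ?B" by simp
  show "real (card ?B) \<le> sqrt (real N) + 1"
  proof (cases "?B = {}")
    case True
    then show ?thesis by (simp only: card.empty) simp
  next
    case False
    define D where "D = {k. t \<le> 2 * 3 ^ k + (1::nat) \<and> 2 * 3 ^ k + 1 < t + N}"
    obtain n k where "n < N" "t + n = 2 * 3 ^ k + 1" using False by blast
    then have "k \<in> D" by (simp add: D_def)
    then have Dne: "D \<noteq> {}" by blast
    define k0 where "k0 = (LEAST k. k \<in> D)"
    have k0: "k0 \<in> D" unfolding k0_def using Dne by (meson LeastI_ex all_not_in_conv)
    have k0_le: "k0 \<le> k" if "k \<in> D" for k unfolding k0_def using that by (rule Least_le)
    \<comment> \<open>With \<open>k = k0 + j\<close>, both exponents in the window give
      \<open>2 * 3 ^ k0 * (3 ^ j - 1) < N\<close>.\<close>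
    have "(k - k0) ^ 2 < N" if k: "k \<in> D" for k
    proof -
      define j where "j = k - k0"
      have kj: "k = k0 + j" using k0_le[OF k] by (simp add: j_def)
      have "2 * 3 ^ k0 * 3 ^ j < 2 * 3 ^ k0 + N"
        using k k0 by (simp add: D_def kj power_add)
      moreover have "2 * 3 ^ k0 * (j ^ 2 + 1) \<le> 2 * 3 ^ k0 * (3::nat) ^ j"
        using square_less_power_3 by (rule mult_le_mono2)
      moreover have "1 * j ^ 2 \<le> 2 * 3 ^ k0 * j ^ 2" by (intro mult_le_mono1) simp
      ultimately show ?thesis unfolding j_def[symmetric] distrib_left by linarith
    qed
    then have sq: "real (k - k0) \<le> sqrt (real N)" if "k \<in> D" for k
      using that by (intro real_le_rsqrt) (metis less_imp_le of_nat_le_iff of_nat_power)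
    define m where "m = nat \<lfloor>sqrt (real N)\<rfloor>"
    have "?B \<subseteq> (\<lambda>j. 2 * 3 ^ (k0 + j) + 1 - t) ` {..m}"
    proof
      fix n assume "n \<in> ?B"
      then obtain k where k: "n < N" "t + n = 2 * 3 ^ k + 1" by blast
      then have kD: "k \<in> D" by (simp add: D_def)
      have "k - k0 \<le> m" using sq[OF kD] by (simp add: m_def le_nat_floor)
      moreover have "n = 2 * 3 ^ (k0 + (k - k0)) + 1 - t" using k k0_le[OF kD] by simp
      ultimately show "n \<in> (\<lambda>j. 2 * 3 ^ (k0 + j) + 1 - t) ` {..m}" by blast
    qed
    then have "card ?B \<le> card ((\<lambda>j. 2 * 3 ^ (k0 + j) + 1 - t) ` {..m})" by (intro card_mono) auto
    also have "\<dots> \<le> card {..m}" by (rule card_image_le) simp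
    finally have "real (card ?B) \<le> real m + 1" by simp
    also have "real m \<le> sqrt (real N)" by (simp add: m_def)
    finally show ?thesis by simp
  qed
qed

lemma sum_le_exceptional:
  fixes f :: "nat \<Rightarrow> real"
  assumes "\<And>n. n < N \<Longrightarrow> f n \<le> c" "\<And>n. n < N \<Longrightarrow> n \<notin> B \<Longrightarrow> f n \<le> e" "finite B" "0 \<le> c" "0 \<le> e"
  shows "(\<Sum>n<N. f n) \<le> real N * e + real (card B) * c"
proof -
  have "(\<Sum>n<N. f n) \<le> (\<Sum>n<N. e + (if n \<in> B then c else 0))"
    using assms by (intro sum_mono) (auto intro: add_increasing)
  also have "\<dots> = real N * e + (\<Sum>n\<in>{..<N} \<inter> B. c)"
    by (simp add: sum.distrib sum.If_cases)
  also have "\<dots> \<le> real N * e + real (card B) * c"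
    using assms card_mono[of B "{..<N} \<inter> B"] by (simp add: mult_right_mono)
  finally show ?thesis .
qed

text \<open>At an exceptional time the walker or the live particle sits in \<open>F\<close>. The
  walker visits each point at most once, and a particle at height \<open>p\<close> forces
  \<open>r + p + n = 2 * 3 ^ k + 1\<close>, which is counted by \<open>card_arrival_times\<close>.
  The count does not depend on \<open>q\<close>, so the means converge uniformly.\<close>

lemma walk_op_exceptional_times:
  assumes F: "finite F" "\<And>q. q \<notin> F \<Longrightarrow> \<bar>a q\<bar> \<le> e / 2" and e: "0 \<le> e"
  shows "\<exists>B. finite B \<and> real (card B) \<le> real (card F) * (sqrt (real N) + 2)
    \<and> (\<forall>n<N. n \<notin> B \<longrightarrow> \<bar>(walk_op ^^ n) a q\<bar> \<le> e)"
proof -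
  obtain i r where q: "q = (i, r)" by (cases q)
  show ?thesis
  proof (cases i)
    case 0
    define B where "B = {n. n \<le> r \<and> (0, r - n) \<in> F}"
    have inj: "inj_on (\<lambda>n. (0::nat, r - n)) B" "(\<lambda>n. (0, r - n)) ` B \<subseteq> F"
      by (auto simp: inj_on_def B_def)
    note cB = inj_on_finite[OF inj F(1)] card_inj_on_le[OF inj F(1)]
    have "real (card B) * 1 \<le> real (card F) * (sqrt (real N) + 2)"
      using cB by (intro mult_mono) (auto simp: add_increasing)
    moreover have "\<bar>(walk_op ^^ n) a q\<bar> \<le> e" if "n \<notin> B" for n
      using F(2)[of "(0, r - n)"] e that by (auto simp: q 0 walk_op_funpow_0 B_def)
    ultimately show ?thesis using cB(1) by (intro exI[of _ B]) simp
  next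
    case (Suc j)
    define B1 where "B1 = {n. (Suc j, r + n) \<in> F}"
    define B2 where "B2 p = {n. n < N \<and> (\<exists>k. (r + p) + n = 2 * 3 ^ k + (1::nat))}" for p
    define B where "B = B1 \<union> (\<Union>p\<in>snd ` F. B2 p)"
    have inj: "inj_on (\<lambda>n. (Suc j, r + n)) B1" "(\<lambda>n. (Suc j, r + n)) ` B1 \<subseteq> F"
      by (auto simp: inj_on_def B1_def)
    note cB1 = inj_on_finite[OF inj F(1)] card_inj_on_le[OF inj F(1)]
    have cB2: "finite (B2 p)" "real (card (B2 p)) \<le> sqrt (real N) + 1" for p
      unfolding B2_def using card_arrival_times by auto
    have "real (card (\<Union>p\<in>snd ` F. B2 p)) \<le> real (\<Sum>p\<in>snd ` F. card (B2 p))"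
      using F(1) by (intro of_nat_mono card_UN_le) auto
    also have "\<dots> = (\<Sum>p\<in>snd ` F. real (card (B2 p)))" by simp
    also have "\<dots> \<le> real (card (snd ` F)) * (sqrt (real N) + 1)"
      using cB2(2) by (rule sum_bounded_above)
    also have "\<dots> \<le> real (card F) * (sqrt (real N) + 1)"
      using card_image_le[OF F(1)] by (intro mult_right_mono) (auto simp: add_nonneg_nonneg)
    finally have "real (card (\<Union>p\<in>snd ` F. B2 p)) \<le> real (card F) * (sqrt (real N) + 1)" .
    moreover have "real (card B) \<le> real (card B1) + real (card (\<Union>p\<in>snd ` F. B2 p))"
      unfolding B_def using card_Un_le of_nat_mono by (metis of_nat_add)
    ultimately have "real (card B) \<le> real (card F) * (sqrt (real N) + 2)"
      using cB1(2) by (simp add: algebra_simps)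
    moreover have "finite B" using cB1 cB2 F(1) by (auto simp: B_def)
    moreover have "\<bar>(walk_op ^^ n) a q\<bar> \<le> e" if n: "n < N" "n \<notin> B" for n
    proof -
      have 1: "\<bar>a (Suc j, r + n)\<bar> \<le> e / 2" using n by (intro F(2)) (auto simp: B_def B1_def)
      show ?thesis
      proof (cases rule: emissions_cases[of j r n])
        case 1
        then show ?thesis using \<open>\<bar>a (Suc j, r + n)\<bar> \<le> e / 2\<close> e
          by (simp add: q Suc walk_op_funpow_Suc)
      next
        case (2 s)
        let ?p = "2 * s + 1 - (r + n)"
        have "s \<in> emissions j r n" using 2 by simp
        then obtain k where "s = 3 ^ k" "r + n \<le> 2 * s + 1" by (auto simp: emissions_def powers_of_3_def)
        then have "n \<in> B2 ?p" using n by (auto simp: B2_def intro!: exI[of _ k])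
        then have "(0, ?p) \<notin> F" using n(2) by (force simp: B_def)
        then have "\<bar>a (0, ?p)\<bar> \<le> e / 2" by (rule F(2))
        then show ?thesis using 1 2 by (simp add: q Suc walk_op_funpow_Suc)
      qed
    qed
    ultimately show ?thesis by blast
  qed
qed

section \<open>Null families and the means of the walk\<close>

definition null_family :: "('i \<Rightarrow> real) \<Rightarrow> bool" where
  "null_family a \<longleftrightarrow> (\<forall>e>0. finite {q. e \<le> \<bar>a q\<bar>})"

lemma null_family_iff_decode:
  "null_family a \<longleftrightarrow> (\<lambda>n. a (prod_decode n)) \<longlonglongrightarrow> 0"
proof
  assume a: "null_family a"
  show "(\<lambda>n. a (prod_decode n)) \<longlonglongrightarrow> 0"
  proof (rule LIMSEQ_I)
    fix e :: real assume "0 < e"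
    then have "finite (prod_encode ` {q. e \<le> \<bar>a q\<bar>})" using a by (simp add: null_family_def)
    then obtain m where m: "\<And>k. k \<in> prod_encode ` {q. e \<le> \<bar>a q\<bar>} \<Longrightarrow> k < m"
      by (meson finite_nat_set_iff_bounded)
    have "\<bar>a (prod_decode n)\<bar> < e" if "m \<le> n" for n
    proof (rule ccontr)
      assume "\<not> ?thesis"
      then have "prod_encode (prod_decode n) \<in> prod_encode ` {q. e \<le> \<bar>a q\<bar>}" by (intro imageI) simp
      then show False using m[of n] that by simp
    qed
    then show "\<exists>m. \<forall>n\<ge>m. norm (a (prod_decode n) - 0) < e" by auto
  qed
next
  assume lim: "(\<lambda>n. a (prod_decode n)) \<longlonglongrightarrow> 0"
  show "null_family a"
    unfolding null_family_def
  proof (intro allI impI)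
    fix e :: real assume "0 < e"
    then obtain m where m: "\<And>n. m \<le> n \<Longrightarrow> \<bar>a (prod_decode n)\<bar> < e"
      using LIMSEQ_D[OF lim] by force
    have "{q. e \<le> \<bar>a q\<bar>} \<subseteq> prod_decode ` {..<m}"
    proof
      fix q assume "q \<in> {q. e \<le> \<bar>a q\<bar>}"
      then have "prod_encode q < m" using m[of "prod_encode q"] by (force simp: not_le[symmetric])
      then have "prod_decode (prod_encode q) \<in> prod_decode ` {..<m}" by (intro imageI) simp
      then show "q \<in> prod_decode ` {..<m}" by simp
    qed
    then show "finite {q. e \<le> \<bar>a q\<bar>}" by (rule finite_subset) simp
  qed
qed

lemma null_family_bounded:
  assumes "null_family a"
  obtains c where "0 \<le> c" "\<And>q. \<bar>a q\<bar> \<le> c"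
proof -
  have fin: "finite {q. 1 \<le> \<bar>a q\<bar>}" using assms by (simp add: null_family_def)
  have "\<bar>a q\<bar> \<le> 1 + (\<Sum>q | 1 \<le> \<bar>a q\<bar>. \<bar>a q\<bar>)" for q
  proof (cases "1 \<le> \<bar>a q\<bar>")
    case True
    then have "\<bar>a q\<bar> \<le> (\<Sum>q | 1 \<le> \<bar>a q\<bar>. \<bar>a q\<bar>)"
      using fin by (intro member_le_sum) auto
    then show ?thesis by simp
  next
    case False
    then show ?thesis by (simp add: add_increasing2 sum_nonneg)
  qed
  moreover have "0 \<le> 1 + (\<Sum>q | 1 \<le> \<bar>a q\<bar>. \<bar>a q\<bar>)" by (simp add: sum_nonneg add_nonneg_nonneg)
  ultimately show thesis using that by blast
qed

lemma null_family_walk_op: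
  assumes "null_family a"
  shows "null_family (walk_op a)"
  unfolding null_family_def
proof (intro allI impI)
  fix e :: real assume e: "0 < e"
  define F where "F = {q. e / 2 \<le> \<bar>a q\<bar>}"
  have F: "finite F"
    unfolding F_def by (rule assms[unfolded null_family_def, rule_format]) (use e in simp)
  \<comment> \<open>The three sets collect the possible sources of a large value: a descending
    particle, the step of the walker, and an emission.\<close>
  have "{q. e \<le> \<bar>walk_op a q\<bar>}
      \<subseteq> (\<lambda>(i, m). (i, Suc m)) ` F \<union> (\<lambda>(i, r). (i, r - 1)) ` F \<union> (\<Union>(j, r)\<in>F. Suc ` {..r} \<times> {r})"
  proof
    fix q assume "q \<in> {q. e \<le> \<bar>walk_op a q\<bar>}"
    then have q: "e \<le> \<bar>walk_op a q\<bar>" by simp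
    obtain i r where ir: "q = (i, r)" by (cases q)
    show "q \<in> (\<lambda>(i, m). (i, Suc m)) ` F \<union> (\<lambda>(i, r). (i, r - 1)) ` F \<union> (\<Union>(j, r)\<in>F. Suc ` {..r} \<times> {r})"
    proof (cases i)
      case 0
      then obtain m where "r = Suc m" "e \<le> \<bar>a (0, m)\<bar>"
        using q e ir by (cases r) (auto simp: walk_op_simps)
      then have "(0, m) \<in> F" using e by (simp add: F_def)
      then show ?thesis using 0 ir \<open>r = Suc m\<close> by force
    next
      case (Suc j)
      have "(Suc j, Suc r) \<in> F \<or> (j \<le> r \<and> (0, r) \<in> F)"
        using q e by (auto simp: ir Suc walk_op_simps F_def split: if_splits)
      then show ?thesis using Suc ir by force
    qed
  qed
  then show "finite {q. e \<le> \<bar>walk_op a q\<bar>}"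
    by (rule finite_subset) (use F in auto)
qed

lemma walk_op_mean:
  assumes a: "null_family a" and e: "0 < e"
  shows "\<forall>\<^sub>F N in sequentially. \<forall>q. \<bar>(1 / real N) * (\<Sum>n<N. (walk_op ^^ n) a q)\<bar> \<le> e"
proof -
  obtain c where c: "0 \<le> c" "\<And>q. \<bar>a q\<bar> \<le> c" using null_family_bounded[OF a] by blast
  \<comment> \<open>Outside \<open>F\<close> two contributions of at most \<open>e / 4\<close> make
    \<open>e / 2\<close>; the exceptional times, of order \<open>sqrt N\<close>, use up the other
    half.\<close>
  define F where "F = {q. e / 4 \<le> \<bar>a q\<bar>}"
  have F: "\<bar>a q\<bar> \<le> (e / 2) / 2" if "q \<notin> F" for q
    using that by (simp add: F_def)
  have finF: "finite F"
    unfolding F_def by (rule a[unfolded null_family_def, rule_format]) (use e in simp)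
  let ?K = "real (card F) * (2 * c)"
  have "(\<lambda>N. ?K * (inverse (sqrt (real N)) + 2 * inverse (real N))) \<longlonglongrightarrow> ?K * (0 + 2 * 0)"
    by (intro tendsto_mult tendsto_add tendsto_const tendsto_inverse_0_at_top
        filterlim_compose[OF sqrt_at_top] filterlim_real_sequentially)
  then have "\<forall>\<^sub>F N in sequentially. ?K * (inverse (sqrt (real N)) + 2 * inverse (real N)) < e / 2"
    using e by (intro order_tendstoD) auto
  then show ?thesis using eventually_gt_at_top[of 0]
  proof eventually_elim
    case (elim N)
    show ?case
    proof
      fix q
      have "\<exists>B. finite B \<and> real (card B) \<le> real (card F) * (sqrt (real N) + 2)
          \<and> (\<forall>n<N. n \<notin> B \<longrightarrow> \<bar>(walk_op ^^ n) a q\<bar> \<le> e / 2)"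
        by (rule walk_op_exceptional_times[OF finF F]) (use e in simp_all)
      then obtain B where B: "finite B" "real (card B) \<le> real (card F) * (sqrt (real N) + 2)"
        "\<And>n. n < N \<Longrightarrow> n \<notin> B \<Longrightarrow> \<bar>(walk_op ^^ n) a q\<bar> \<le> e / 2"
        by blast
      have "\<bar>\<Sum>n<N. (walk_op ^^ n) a q\<bar> \<le> (\<Sum>n<N. \<bar>(walk_op ^^ n) a q\<bar>)" by (rule sum_abs)
      also have "\<dots> \<le> real N * (e / 2) + real (card B) * (2 * c)"
        using walk_op_bound[OF c(2)] B e c by (intro sum_le_exceptional) auto
      also have "\<dots> \<le> real N * (e / 2) + (real (card F) * (sqrt (real N) + 2)) * (2 * c)"
        using B(2) c by (intro add_left_mono mult_right_mono) auto
      finally have "\<bar>\<Sum>n<N. (walk_op ^^ n) a q\<bar> / real N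
          \<le> (real N * (e / 2) + (real (card F) * (sqrt (real N) + 2)) * (2 * c)) / real N"
        by (rule divide_right_mono) simp
      also have "\<dots> = e / 2 + ?K * ((sqrt (real N) + 2) / real N)"
        using elim by (simp add: field_simps)
      also have "(sqrt (real N) + 2) / real N = inverse (sqrt (real N)) + 2 * inverse (real N)"
        using sqrt_divide_self_eq[of "real N"] by (simp add: add_divide_distrib divide_inverse[of 2])
      finally show "\<bar>(1 / real N) * (\<Sum>n<N. (walk_op ^^ n) a q)\<bar> \<le> e"
        using elim by (simp add: abs_mult)
    qed
  qed
qed

text \<open>The only live particle at this time is the one emitted at \<open>3 ^ j\<close>, and its
  height has just become 0; the walker itself is never at \<open>(0, 0)\<close>.\<close>

lemma walk_op_return:
  assumes "i \<le> 3 ^ j"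
  shows "(walk_op ^^ (2 * 3 ^ j + 1)) (\<lambda>q. if q = (0, 0) then 1 else 0) (Suc i, 0) = 1"
proof -
  have mem: "3 ^ j \<in> emissions i 0 (2 * 3 ^ j + 1)"
    using assms by (auto simp: emissions_def powers_of_3_def)
  then have "emissions i 0 (2 * 3 ^ j + 1) = {3 ^ j}" using emissions_unique[OF mem] by blast
  then show ?thesis by (simp only: walk_op_funpow_Suc) simp
qed

lemma (in norm_bounded_disjoint) exists_mean_ergodic_not_wap:
  obtains T :: "'a \<Rightarrow> 'a" where "bounded_linear T" "positive_operator T" "power_bounded T"
    "mean_ergodic T" "\<not> weakly_almost_periodic T"
proof -
  obtain \<phi> where \<phi>: "\<And>i. linear (\<phi> i)" "\<And>i y. 0 \<le> y \<Longrightarrow> 0 \<le> \<phi> i y"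
    "\<And>i. \<phi> i (u i) = 1" "\<And>i y. \<bar>\<phi> i y\<bar> \<le> (1 / d) * norm y"
    "\<And>i y. 0 \<le> y \<Longrightarrow> inf y (u i) = 0 \<Longrightarrow> \<phi> i y = 0"
    "\<And>i y e. 0 \<le> y \<Longrightarrow> 0 < e \<Longrightarrow> \<exists>k\<ge>0. d * \<phi> i y \<le> norm (inf y (k *\<^sub>R u i)) + e"
    using biorthogonal_functionals[of d u, OF d_pos u_nonneg u_norm] by metis
  define L :: "(nat \<times> nat \<Rightarrow> real) set" where "L = {a. null_family a}"
  define J' where "J' a = J (\<lambda>n. a (prod_decode n))" for a :: "nat \<times> nat \<Rightarrow> real"
  define \<psi> where "\<psi> q = \<phi> (prod_encode q)" for q
  have "sequence_copy c0 J \<phi> M (1 / d)"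
    by (rule sequence_copy_c0) (use \<phi> in blast)+
  then have "sequence_copy {a. (\<lambda>n. a (prod_decode n)) \<in> c0} (\<lambda>a. J (\<lambda>n. a (prod_decode n)))
      (\<lambda>q. \<phi> (prod_encode q)) M (1 / d)"
    by (rule sequence_copy_reindex) simp_all
  moreover have "{a. (\<lambda>n. a (prod_decode n)) \<in> c0} = L"
    by (simp add: L_def null_family_iff_decode c0_def)
  ultimately interpret C: sequence_copy L J' \<psi> M "1 / d"
    by (simp add: J'_def[abs_def] \<psi>_def[abs_def])
  interpret O: sequence_operator L J' \<psi> M "1 / d" walk_op 2
  proof
    show "walk_op a \<in> L" if "a \<in> L" for a
      using that null_family_walk_op by (simp add: L_def)
    show "walk_op (\<lambda>i. a i + b i) = (\<lambda>i. walk_op a i + walk_op b i)" for a b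
      by (auto simp: fun_eq_iff walk_op_def split: nat.split)
    show "walk_op (\<lambda>i. c * a i) = (\<lambda>i. c * walk_op a i)" for a c
      by (auto simp: fun_eq_iff walk_op_def algebra_simps split: nat.split)
    show "0 \<le> walk_op a q" if "\<And>q. 0 \<le> a q" for a q
      using that by (auto simp: walk_op_def split: prod.split nat.split)
    show "\<bar>(walk_op ^^ n) a q\<bar> \<le> 2 * c" if "\<And>q. \<bar>a q\<bar> \<le> c" for a c n q
      using that by (rule walk_op_bound)
    show "\<exists>b\<in>L. \<forall>e>0. \<forall>\<^sub>F N in sequentially.
      \<forall>q. \<bar>(1 / real N) * (\<Sum>n<N. (walk_op ^^ n) a q) - b q\<bar> \<le> e" if "a \<in> L" for a
    proof (rule bexI)
      show "\<forall>e>0. \<forall>\<^sub>F N in sequentially.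
        \<forall>q. \<bar>(1 / real N) * (\<Sum>n<N. (walk_op ^^ n) a q) - (\<lambda>q. 0) q\<bar> \<le> e"
        using walk_op_mean[of a] \<open>a \<in> L\<close> by (simp add: L_def)
      show "(\<lambda>q. 0) \<in> L" by (simp add: L_def null_family_def)
    qed
  qed
  have "\<not> weakly_almost_periodic O.T"
  proof
    assume wap: "weakly_almost_periodic O.T"
    define a :: "nat \<times> nat \<Rightarrow> real" where "a = (\<lambda>q. if q = (0, 0) then 1 else 0)"
    have aL: "a \<in> L"
    proof -
      have "{q. e \<le> \<bar>a q\<bar>} \<subseteq> {(0, 0)}" if "0 < e" for e using that by (auto simp: a_def)
      then show ?thesis by (auto simp: L_def null_family_def intro: finite_subset)
    qed
    obtain y where y: "\<And>f l. bounded_linear f \<Longrightarrow>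
        (\<lambda>j. f (J' ((walk_op ^^ (2 * 3 ^ j + 1)) a))) \<longlonglongrightarrow> (l::real) \<Longrightarrow> f y = l"
      using O.weak_cluster_point_of_powers[OF wap aL, of "\<lambda>j. 2 * 3 ^ j + 1"] by blast
    \<comment> \<open>Each of these coordinates is eventually 1 along the chosen times, so
      \<open>y\<close> would have infinitely many coordinates equal to 1.\<close>
    have "\<psi> (Suc i, 0) y = 1" for i
    proof (rule y[OF C.bounded_linear_phi])
      have "\<psi> (Suc i, 0) (J' ((walk_op ^^ (2 * 3 ^ j + 1)) a)) = 1" if "i \<le> j" for j
      proof -
        have "j < 3 ^ j" by (rule less_exp[of j, THEN order_less_le_trans]) (simp add: power_mono)
        then show ?thesis
          using walk_op_return[of i j] that by (simp only: C.phi_J[OF O.An_L[OF aL]]) (simp add: a_def)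
      qed
      then show "(\<lambda>j. \<psi> (Suc i, 0) (J' ((walk_op ^^ (2 * 3 ^ j + 1)) a))) \<longlonglongrightarrow> 1"
        by (intro tendsto_eventually) (auto simp: eventually_sequentially)
    qed
    then have "range (\<lambda>i. (Suc i, 0)) \<subseteq> {q. 1 \<le> \<bar>\<psi> q y\<bar>}" by auto
    moreover have "finite {q. 1 \<le> \<bar>\<psi> q y\<bar>}" using C.phi_L[of y] by (simp add: L_def null_family_def)
    ultimately have "finite (range (\<lambda>i::nat. (Suc i, 0::nat)))" by (rule finite_subset)
    moreover have "infinite (range (\<lambda>i::nat. (Suc i, 0::nat)))"
      by (rule range_inj_infinite) (simp add: inj_def)
    ultimately show False by blast
  qed
  then show thesis
    using that O.bounded_linear_T O.positive_T O.power_bounded_T O.mean_ergodic_T by blast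
qed

theorem theorem3p3:
  assumes "countably_order_complete TYPE('a::banach_lattice)"
    and "\<And>T :: 'a \<Rightarrow> 'a. bounded_linear T \<Longrightarrow> positive_operator T \<Longrightarrow> power_bounded T \<Longrightarrow>
           mean_ergodic T \<Longrightarrow> weakly_almost_periodic T"
  shows "KB_space TYPE('a)"
proof (rule ccontr)
  assume "\<not> KB_space TYPE('a)"
  then obtain X :: "nat \<Rightarrow> 'a" where X: "\<And>n. 0 \<le> X n" "incseq X" "bounded (range X)" "\<not> convergent X"
    by (auto simp: KB_space_def)
  show False
  proof (cases "order_continuous_norm TYPE('a)")
    case True
    obtain y :: "nat \<Rightarrow> 'a" and \<delta> M where y: "0 < \<delta>" "\<And>n. 0 \<le> y n" "\<And>n. \<delta> \<le> norm (y n)"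
      "\<And>N. norm (\<Sum>n<N. y n) \<le> M"
      using norm_bounded_blocks[OF X] by metis
    obtain u :: "nat \<Rightarrow> 'a" where u: "\<And>n. 0 \<le> u n" "\<And>n. \<delta> / 4 \<le> norm (u n)"
      "\<And>N. norm (\<Sum>n<N. u n) \<le> M" "\<And>m n. m \<noteq> n \<Longrightarrow> inf (u m) (u n) = 0"
      using norm_bounded_disjoint_sequence[OF True y] by metis
    interpret norm_bounded_disjoint u "\<delta> / 4" M
      using True y(1) u by unfold_locales auto
    show False
      by (rule exists_mean_ergodic_not_wap) (use assms(2) in blast)
  next
    case False
    \<comment> \<open>The norm bounded sequence is dropped here in favour of an order bounded
      divergent one.\<close>
    then obtain X :: "nat \<Rightarrow> 'a" and b
      where X: "\<And>n. 0 \<le> X n" "incseq X" "\<And>n. X n \<le> b" "\<not> convergent X"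
      by (auto simp: order_continuous_norm_def)
    obtain u :: "nat \<Rightarrow> 'a" and x d where u: "0 < d" "\<And>n. 0 \<le> u n" "\<And>n. u n \<le> x"
      "\<And>n. d \<le> norm (u n)" "\<And>m n. m \<noteq> n \<Longrightarrow> inf (u m) (u n) = 0"
      using order_bounded_disjoint_sequence[OF assms(1) X] by metis
    interpret order_bounded_disjoint u x
      using assms(1) u by unfold_locales auto
    show False
      by (rule exists_mean_ergodic_not_wap[OF u(1) u(4)]) (use assms(2) in blast)
  qed
qed

end
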